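(* Let $C_n$ be any of the algebras $C_{n,\pm}$. The set $\mathcal{B}(r)=\mathcal{C}_{n,r}\,\mathcal{B}_{r}\,e_{(r)}\,\mathcal{B}_{r}^T\,\mathcal{D}_{n,r}^T$ spans $H_ne_{(r)}H_n$ for $1\le r\le n$, and hence $\mathcal{B}=\bigcup_{r=0}^n\mathcal{B}(r)$ spans $C_n$, where $\mathcal{B}(0)$ is defined by the same formula with $e_{(0)}=1$.
   Context: Hecke algebra: $H_n=H_n(q)$ has generators $g_i$, $1\le i<n$, and relations $g_ig_{i+1}g_i=g_{i+1}g_ig_{i+1}$, $g_ig_j=g_jg_i$ for $|i-j|\ne1$, $g_i^2=(q-q^{-1})g_i+1$. Put $u_i=q-g_i$. Algebras: $C_{n,\pm}=C_{n,\pm}(p,q)$ is the unital algebra with generators $u_i$ ($1\le i<n$), $e_{(r)}$ ($1\le r\le n$), where $e_{(0)}=1$ and $e=e_{(1)}$, either over $\mathbb{C}(p,q)$ with $p,q$ independent variables, or over $\mathbb{C}(q)$ with $p=q^N$, $N>1$ odd. Relations: (a) the $u_i$ satisfy the Hecke algebra relations (that is, the elements $g_i=q-u_i$ satisfy the relations above); (b) the $e_{(r)}$ are idempotents, and for $1\le r<n$: $e_{(r+1)}=e_{(r)}u_re_{(r)}-\frac{p^{1/2}q^{-1}-p^{-1/2}q}{p^{1/2}-p^{-1/2}}e_{(r)}$ for $C_{n,+}$, resp. $e_{(r+1)}=\frac{p^{1/2}q^{-1}+p^{-1/2}q}{p^{1/2}+p^{-1/2}}e_{(r)}-e_{(r)}u_re_{(r)}$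 for $C_{n,-}$ (the coefficients are rational in $p,q$); (c) for $2\le j<r\le n$: $(u_{j-1}u_j-u_{j-1})e_{(r)}=(u_ju_{j-1}-u_j)e_{(r)}$ for $C_{n,+}$, resp. $(u_{j-1}u_j+u_{j-1})e_{(r)}=(u_ju_{j-1}+u_j)e_{(r)}$ for $C_{n,-}$. We write $H_n$ also for its image in $C_n$; $H_ne_{(r)}H_n$ is the linear span of all products $he_{(r)}h'$ with $h,h'\in H_n$. Sets: For $w\in S_n$, $h_w$ is the product of the $g_i$ corresponding to any reduced expression of $w$ in the simple reflections $s_i=(i,i+1)$. Put $h_w^T=h_{w^{-1}}$, extended linearly, and $\mathcal{S}^T=\{h^T:h\in\mathcal{S}\}$ for $\mathcal{S}\subset H_n$. $\mathcal{C}_{n,r}=\{h_w\}$ with $w$ ranging over the shortest elements of the left cosets of $S_r\subset S_n$; $\mathcal{D}_{n,r}=\{h_w\}$ with $w$ ranging over the shortest elements of the left cosets of $S_r\times S_{n-r}\subset S_n$ (here $S_r$ permutes $1,\dots,r$ and $S_{n-r}$ permutes $r+1,\dots,n$). $\mathcal{B}_0=\mathcal{B}_1=\{1\}$ and $\mathcal{B}_{r+1}=\mathcal{B}_r\cup\bigcup_{j=1}^rg_jg_{j+1}\cdots g_r\,\mathcal{B}_{r-1}$ for $r\ge1$. Products of sets are sets of all products.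
   Formalization: Two families of relations are added to (a)-(c) in C_n: e_(r)u_j=u_je_(r) for 1≤r<j<n, and relation (c) with the order of all products reversed; with (a)-(c) alone the claim already fails for n=3. *)

theory Defs
  imports
    "HOL-Algebra.QuotRing"
    "HOL-Algebra.Module"
    "HOL-Library.Poly_Mapping"
    "HOL-Computational_Algebra.Polynomial"
    "HOL-Computational_Algebra.Fraction_Field"
    "HOL-Combinatorics.Permutations"
begin

subsection \<open>Algebras given by generators and relations\<close>

text \<open>
  The free monoid on \<open>'x\<close>. With this instance, \<open>'x word \<Rightarrow>\<^sub>0 'k\<close>
  is the free associative unital \<open>'k\<close>-algebra on \<open>'x\<close> (finitely supported functions
  with convolution product).
\<close>

datatype 'x word = Word (letters: "'x list")

instantiation word :: (type) monoid_add
begin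

definition zero_word :: "'x word" where "zero_word = Word []"

definition plus_word :: "'x word \<Rightarrow> 'x word \<Rightarrow> 'x word"
  where "plus_word v w = Word (letters v @ letters w)"

instance
  by standard (auto simp: zero_word_def plus_word_def)

end

definition var :: "'x \<Rightarrow> 'x word \<Rightarrow>\<^sub>0 'k::field"
  where "var x = Poly_Mapping.single (Word [x]) 1"

definition const :: "'k::field \<Rightarrow> 'x word \<Rightarrow>\<^sub>0 'k"
  where "const c = Poly_Mapping.single 0 c"

definition free_algebra :: "'x set \<Rightarrow> ('x word \<Rightarrow>\<^sub>0 'k::field) ring"
  where "free_algebra X =
    \<lparr>carrier = {f. \<forall>w\<in>Poly_Mapping.keys f. set (letters w) \<subseteq> X},
     monoid.mult = (*), one = 1, zero = 0, add = (+)\<rparr>"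

text \<open>
  The projection of the free algebra on \<open>X\<close> onto its quotient by the two-sided ideal
  generated by the relators \<open>R\<close>.
\<close>

definition proj ::
    "'x set \<Rightarrow> ('x word \<Rightarrow>\<^sub>0 'k::field) set \<Rightarrow> ('x word \<Rightarrow>\<^sub>0 'k) \<Rightarrow> ('x word \<Rightarrow>\<^sub>0 'k) set"
  where "proj X R f = genideal (free_algebra X) R +>\<^bsub>free_algebra X\<^esub> f"

text \<open>
  The unital algebra with generators \<open>X\<close> and relators \<open>R\<close>: the quotient ring, extended
  by the scalar multiplication. (The library record for modules is used for its \<open>smult\<close>
  field only; the scalars are the elements of the type \<open>'k\<close>.)
\<close>

definition presented_algebra ::
    "'x set \<Rightarrow> ('x word \<Rightarrow>\<^sub>0 'k::field) set \<Rightarrow> ('k, ('x word \<Rightarrow>\<^sub>0 'k) set) module"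
  where "presented_algebra X R =
    (let Q = free_algebra X Quot genideal (free_algebra X) R
     in ring.extend Q (module.fields (\<lambda>c a. proj X R (const c) \<otimes>\<^bsub>Q\<^esub> a)))"

definition lspan :: "('k, 'a, 'm) module_scheme \<Rightarrow> 'a set \<Rightarrow> 'a set"
  where "lspan A S = {(\<Oplus>\<^bsub>A\<^esub>a\<in>t. c a \<odot>\<^bsub>A\<^esub> a) | t c. finite t \<and> t \<subseteq> S}"


subsection \<open>The algebras \<open>C\<^sub>n\<close>\<close>

datatype sign = Plus | Minus

text \<open>\<open>U i\<close> and \<open>E r\<close> stand for the generators $u_i$ and $e_{(r)}$.\<close>

datatype gen = U nat | E nat

definition uX :: "nat \<Rightarrow> gen word \<Rightarrow>\<^sub>0 'k::field" where "uX i = var (U i)"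

definition gX :: "'k::field \<Rightarrow> nat \<Rightarrow> gen word \<Rightarrow>\<^sub>0 'k" where "gX q i = const q - uX i"

definition eX :: "nat \<Rightarrow> gen word \<Rightarrow>\<^sub>0 'k::field"
  where "eX r = (if r = 0 then 1 else var (E r))"

definition hecke_rels :: "nat \<Rightarrow> 'k::field \<Rightarrow> (gen word \<Rightarrow>\<^sub>0 'k) set"
  where "hecke_rels n q =
    {gX q i * gX q (i+1) * gX q i - gX q (i+1) * gX q i * gX q (i+1) | i. 1 \<le> i \<and> i + 1 < n} \<union>
    {gX q i * gX q j - gX q j * gX q i | i j.
       i \<in> {1..<n} \<and> j \<in> {1..<n} \<and> \<bar>int i - int j\<bar> \<noteq> 1} \<union>
    {gX q i * gX q i - (const (q - inverse q) * gX q i + 1) | i. i \<in> {1..<n}}"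

text \<open>
  The fraction
  $(p^{1/2}q^{-1} \mp p^{-1/2}q)/(p^{1/2} \mp p^{-1/2})$, with numerator and denominator
  multiplied by $p^{1/2}$.
\<close>

fun e_coeff :: "sign \<Rightarrow> 'k::field \<Rightarrow> 'k \<Rightarrow> 'k" where
  "e_coeff Plus p q = (p * inverse q - q) / (p - 1)"
| "e_coeff Minus p q = (p * inverse q + q) / (p + 1)"

fun e_next :: "sign \<Rightarrow> 'k::field \<Rightarrow> 'k \<Rightarrow> nat \<Rightarrow> gen word \<Rightarrow>\<^sub>0 'k" where
  "e_next Plus p q r = eX r * uX r * eX r - const (e_coeff Plus p q) * eX r"
| "e_next Minus p q r = const (e_coeff Minus p q) * eX r - eX r * uX r * eX r"

definition idem_rels :: "sign \<Rightarrow> nat \<Rightarrow> 'k::field \<Rightarrow> 'k \<Rightarrow> (gen word \<Rightarrow>\<^sub>0 'k) set"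
  where "idem_rels s n p q =
    {eX r * eX r - eX r | r. r \<in> {1..n}} \<union>
    {eX (r+1) - e_next s p q r | r. 1 \<le> r \<and> r < n}"

fun braid_e_left :: "sign \<Rightarrow> nat \<Rightarrow> nat \<Rightarrow> gen word \<Rightarrow>\<^sub>0 'k::field" where
  "braid_e_left Plus j r =
     (uX (j-1) * uX j - uX (j-1)) * eX r - (uX j * uX (j-1) - uX j) * eX r"
| "braid_e_left Minus j r =
     (uX (j-1) * uX j + uX (j-1)) * eX r - (uX j * uX (j-1) + uX j) * eX r"

fun braid_e_right :: "sign \<Rightarrow> nat \<Rightarrow> nat \<Rightarrow> gen word \<Rightarrow>\<^sub>0 'k::field" where
  "braid_e_right Plus j r =
     eX r * (uX j * uX (j-1) - uX (j-1)) - eX r * (uX (j-1) * uX j - uX j)"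
| "braid_e_right Minus j r =
     eX r * (uX j * uX (j-1) + uX (j-1)) - eX r * (uX (j-1) * uX j + uX j)"

definition braid_e_rels :: "sign \<Rightarrow> nat \<Rightarrow> (gen word \<Rightarrow>\<^sub>0 'k::field) set"
  where "braid_e_rels s n = {braid_e_left s j r | j r. 2 \<le> j \<and> j < r \<and> r \<le> n}"

text \<open>
  Two further families of relations, in addition to the Hecke relations, the recursion for the
  idempotents $e_{(r)}$ and the left-handed relations \<open>braid_e_rels\<close>: $e_{(r)}$ only involves
  the first \<open>r\<close> strands, so it commutes with $u_j$ for $j>r$; and \<open>braid_e_rels\<close> is also
  imposed with the order of all products reversed.

  They are imposed here although presentations of $C_n$ may omit them, because neither
  family follows from the other relations, and without either one of them the spanning
  statement for \<open>calB\<close> fails already for $n=3$: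

  (1) Let \<open>c\<close> be the coefficient \<open>e_coeff\<close>. Let $H_3$ act on itself by left multiplication
  and let \<open>e\<close> act by $x \mapsto \varphi(x)1$, for a linear form $\varphi$ with $\varphi(1)=1$
  and $\varphi(u_1)=c$. Then $e^2=e$, $eu_1e=ce$, hence $e_{(2)}=e_{(3)}=0$, and the three
  families hold. But for generic $\varphi$ the operator $eg_2$ is not in the span of the
  operators $heh'$ with $h\in H_3$, $h'\in\{1,g_1,g_1g_2\}$.

  (2) Take $C_{3,+}$ with the commutation relation. Let $H_3$ act on itself by right
  multiplication and, with $f=1+c$ and $[2]=q+q^{-1}$, let \<open>e\<close> act from the right by
  $1e=1$, $u_1e=f$, $u_2e=u_2$, $u_1u_2e=fu_2$, $u_2u_1e=f+cu_2$,
  $u_2u_1u_2e=(f+c[2])u_2$. This is a right module in which \<open>braid_e_rels\<close> holds, and $e_{(3)}$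
  has image spanned by $1$; but $e_{(3)}$ does not satisfy the reversed relation,
  and $H_3e_{(3)}H_3$ acts with dimension 24 whereas $\mathcal{B}(3)$ has 16 elements.
\<close>

definition tacit_rels :: "sign \<Rightarrow> nat \<Rightarrow> (gen word \<Rightarrow>\<^sub>0 'k::field) set"
  where "tacit_rels s n =
    {eX r * uX j - uX j * eX r | r j. 1 \<le> r \<and> r < j \<and> j < n} \<union>
    {braid_e_right s j r | j r. 2 \<le> j \<and> j < r \<and> r \<le> n}"

definition gens :: "nat \<Rightarrow> gen set"
  where "gens n = U ` {1..<n} \<union> E ` {1..n}"

definition rels :: "sign \<Rightarrow> nat \<Rightarrow> 'k::field \<Rightarrow> 'k \<Rightarrow> (gen word \<Rightarrow>\<^sub>0 'k) set"
  where "rels s n p q =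
    hecke_rels n q \<union> idem_rels s n p q \<union> braid_e_rels s n \<union> tacit_rels s n"

definition Cn :: "sign \<Rightarrow> nat \<Rightarrow> 'k::field \<Rightarrow> 'k \<Rightarrow> ('k, (gen word \<Rightarrow>\<^sub>0 'k) set) module"
  where "Cn s n p q = presented_algebra (gens n) (rels s n p q)"


subsection \<open>Permutations\<close>

text \<open>
  Products of permutations are compositions of functions, so the left coset of \<open>w\<close>
  modulo \<open>P\<close> is \<open>{w \<circ> v | v. v \<in> P}\<close>. A list \<open>[i\<^sub>1, \<dots>, i\<^sub>k]\<close> stands for the expression
  $s_{i_1}\cdots s_{i_k}$.
\<close>

definition perm_of :: "nat list \<Rightarrow> nat \<Rightarrow> nat"
  where "perm_of is = foldr (\<lambda>i w. transpose i (i+1) \<circ> w) is id"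

definition expression :: "nat \<Rightarrow> (nat \<Rightarrow> nat) \<Rightarrow> nat list \<Rightarrow> bool"
  where "expression n w is \<longleftrightarrow> set is \<subseteq> {1..<n} \<and> perm_of is = w"

definition len :: "nat \<Rightarrow> (nat \<Rightarrow> nat) \<Rightarrow> nat"
  where "len n w = (LEAST k. \<exists>is. expression n w is \<and> length is = k)"

definition reduced :: "nat \<Rightarrow> (nat \<Rightarrow> nat) \<Rightarrow> nat list \<Rightarrow> bool"
  where "reduced n w is \<longleftrightarrow> expression n w is \<and> length is = len n w"

definition shortest_reps :: "nat \<Rightarrow> (nat \<Rightarrow> nat) set \<Rightarrow> (nat \<Rightarrow> nat) set"
  where "shortest_reps n P = {w. w permutes {1..n} \<and> (\<forall>v\<in>P. len n w \<le> len n (w \<circ> v))}"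


subsection \<open>The spanning sets\<close>

context
  fixes s :: sign and n :: nat and p q :: "'k::field"
begin

definition gC :: "nat \<Rightarrow> (gen word \<Rightarrow>\<^sub>0 'k) set"
  where "gC i = proj (gens n) (rels s n p q) (gX q i)"

definition eC :: "nat \<Rightarrow> (gen word \<Rightarrow>\<^sub>0 'k) set"
  where "eC r = proj (gens n) (rels s n p q) (eX r)"

text \<open>The image of the Hecke algebra, itself a quotient of the free algebra on the \<open>U i\<close>.\<close>

definition Hn :: "(gen word \<Rightarrow>\<^sub>0 'k) set set"
  where "Hn = proj (gens n) (rels s n p q) ` carrier (free_algebra (U ` {1..<n}))"

definition gprod :: "nat list \<Rightarrow> (gen word \<Rightarrow>\<^sub>0 'k) set"
  where "gprod is = foldr (\<lambda>i x. gC i \<otimes>\<^bsub>Cn s n p q\<^esub> x) is \<one>\<^bsub>Cn s n p q\<^esub>"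

text \<open>By Matsumoto's theorem the choice of the reduced expression is immaterial.\<close>

definition hC :: "(nat \<Rightarrow> nat) \<Rightarrow> (gen word \<Rightarrow>\<^sub>0 'k) set"
  where "hC w = gprod (SOME is. reduced n w is)"

text \<open>
  The linear extension of $h_w \mapsto h_{w^{-1}}$ to \<open>Hn\<close>. It is well defined because the
  $h_w$ form a basis of the Hecke algebra, which embeds in $C_n$ (send all $e_{(r)}$, $r\ge1$,
  to \<open>0\<close>).
\<close>

definition tr :: "(gen word \<Rightarrow>\<^sub>0 'k) set \<Rightarrow> (gen word \<Rightarrow>\<^sub>0 'k) set"
  where "tr x = (THE y. \<exists>c.
    x = (\<Oplus>\<^bsub>Cn s n p q\<^esub>w\<in>{w. w permutes {1..n}}. c w \<odot>\<^bsub>Cn s n p q\<^esub> hC w) \<and>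
    y = (\<Oplus>\<^bsub>Cn s n p q\<^esub>w\<in>{w. w permutes {1..n}}. c w \<odot>\<^bsub>Cn s n p q\<^esub> hC (inv_into UNIV w)))"

definition setC :: "nat \<Rightarrow> (gen word \<Rightarrow>\<^sub>0 'k) set set"
  where "setC r = hC ` shortest_reps n {v. v permutes {1..r}}"

definition setD :: "nat \<Rightarrow> (gen word \<Rightarrow>\<^sub>0 'k) set set"
  where "setD r = hC ` shortest_reps n {v \<circ> v' | v v'. v permutes {1..r} \<and> v' permutes {r+1..n}}"

fun setB :: "nat \<Rightarrow> (gen word \<Rightarrow>\<^sub>0 'k) set set" where
  "setB 0 = {\<one>\<^bsub>Cn s n p q\<^esub>}"
| "setB (Suc 0) = {\<one>\<^bsub>Cn s n p q\<^esub>}"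
| "setB (Suc (Suc r)) =
     setB (Suc r) \<union> (\<Union>j\<in>{1..r+1}. {gprod [j..<r+2]} <#>\<^bsub>Cn s n p q\<^esub> setB r)"

definition calB :: "nat \<Rightarrow> (gen word \<Rightarrow>\<^sub>0 'k) set set"
  where "calB r =
    setC r <#>\<^bsub>Cn s n p q\<^esub> setB r <#>\<^bsub>Cn s n p q\<^esub> {eC r}
      <#>\<^bsub>Cn s n p q\<^esub> tr ` setB r <#>\<^bsub>Cn s n p q\<^esub> tr ` setD r"

definition HeH :: "nat \<Rightarrow> (gen word \<Rightarrow>\<^sub>0 'k) set set"
  where "HeH r = lspan (Cn s n p q) (Hn <#>\<^bsub>Cn s n p q\<^esub> {eC r} <#>\<^bsub>Cn s n p q\<^esub> Hn)"

end


subsection \<open>Ground fields\<close>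

text \<open>
  $\mathbb{C}(p,q)$ is realised as the field of fractions of $\mathbb{C}[q][p]$.
\<close>

type_synonym Cpq = "complex poly poly fract"
type_synonym Cq = "complex poly fract"

definition p_var :: Cpq where "p_var = Fract [:0, 1:] 1"
definition q_var :: Cpq where "q_var = Fract [:[:0, 1:]:] 1"
definition q_var1 :: Cq where "q_var1 = Fract [:0, 1:] 1"

end

theory Submission
  imports Defs "HOL-Library.Set_Algebras"
begin

text \<open>
  Computations take place in the free algebra on all generators, modulo the two-sided ideal of
  relations. There a spanning statement about $C_n$ is an equality of subspaces that contain the
  ideal (\<open>cspan\<close>), and these subspaces can be multiplied, and exchanged if their generators commute.
  Write $H_r$ for the span of the words in $g_1,\dots,g_{r-1}$ and $H'$ for the span of the words
  in $g_{r+1},\dots,g_{n-1}$.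

  \<^item> Cosets. By Matsumoto's theorem $h_w$ may be computed from any reduced word. Hence
    $h_{ws_i}$ is $h_wg_i$ or $h_wg_i^{-1}$, which lies in the span of $h_w$ and $h_wg_i$ in both
    cases. So all $h_w$ with \<open>w\<close> in one coset of a parabolic subgroup lie in $h_{w_1}$ times the
    parabolic subalgebra, whichever member $w_1$ of the coset is chosen, in particular a
    shortest one. This gives $H_n=\mathcal{C}_{n,r}H_r$ and $H_n=\mathcal{D}_{n,r}H_rH'$
    (\<open>cspan_monomials_coset\<close>).

  \<^item> The left module $H_re_{(r)}$. The relation between $g_jg_{j-1}e_{(r)}$ and
    $g_{j-1}g_je_{(r)}$ gives, for $m+2\le r$, the recursion
    $H_{m+2}e_{(r)}=H_{m+1}e_{(r)}+H_{m+1}g_{m+1}H_me_{(r)}$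
    (\<open>cspan_monomials_e_step\<close>), which is the recursion that defines $\mathcal{B}_r$. So
    $H_re_{(r)}$ is spanned by $\mathcal{B}_re_{(r)}$.

  \<^item> The two-sided ideal. Reversing words is an antiautomorphism which fixes all generators and
    respects the relations, so the two points above hold with left and right exchanged. Since
    $H'$ commutes with $e_{(r)}$, it can be absorbed into the left factor:
    $H_ne_{(r)}H_n=H_ne_{(r)}H'H_r\mathcal{D}_{n,r}^T=H_ne_{(r)}H_r\mathcal{D}_{n,r}^T
    =\mathcal{C}_{n,r}\mathcal{B}_re_{(r)}\mathcal{B}_r^T\mathcal{D}_{n,r}^T$
    (\<open>cspan_HeH\<close>).

  \<^item> All of $C_n$. The sum of the $H_ne_{(r)}H_n$ with $0\le r\le n$ contains \<open>1\<close>, so it is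
    enough that left multiplication by \<open>e\<close> preserves it. Up to factors that commute with \<open>e\<close>
    or with $e_{(r)}$, the products to be considered are $e\,g_1\cdots g_k\,e_{(r)}$ with $k\le r$.
    For $k<r$ such a product is reduced to $H_ne_{(r)}$ (\<open>e1_chain_e\<close>), and for $k=r$ to
    $H_ne_{(r)}$ and multiples of $e_{(r+1)}$ (\<open>e_chain_e\<close>).

  Word reversal also settles that the map $h_w\mapsto h_{w^{-1}}$ is well defined on the image of
  the Hecke algebra: the reversal of $h_w$ is congruent to $h_{w^{-1}}$, so every way to write an
  element as a combination of the $h_w$ leads to its reversal (\<open>tr_eq\<close>).
\<close>

section \<open>Words in the simple reflections\<close>

text \<open>
  Only the moves that preserve the length are allowed, not the cancellation of a square: they are
  the ones that leave a product of the $g_i$ unchanged.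
\<close>

inductive braid_equiv :: "nat list \<Rightarrow> nat list \<Rightarrow> bool" (infix "\<sim>" 50) where
  braid_refl: "x \<sim> x"
| braid_trans: "x \<sim> y \<Longrightarrow> y \<sim> z \<Longrightarrow> x \<sim> z"
| braid_swap: "0 < i \<Longrightarrow> a @ [i, Suc i, i] @ b \<sim> a @ [Suc i, i, Suc i] @ b"
| braid_swap': "0 < i \<Longrightarrow> a @ [Suc i, i, Suc i] @ b \<sim> a @ [i, Suc i, i] @ b"
| far_swap: "Suc i < j \<or> Suc j < i \<Longrightarrow> a @ [i, j] @ b \<sim> a @ [j, i] @ b"

lemma braid_equiv_sym: "x \<sim> y \<Longrightarrow> y \<sim> x"
  by (induction rule: braid_equiv.induct) (blast intro: braid_equiv.intros)+

lemma braid_equiv_append: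
  assumes "x \<sim> y" shows "a @ x @ b \<sim> a @ y @ b"
  using assms
proof (induction rule: braid_equiv.induct)
  case (braid_swap i c d)
  then show ?case using braid_equiv.braid_swap[of i "a @ c" "d @ b"] by simp
next
  case (braid_swap' i c d)
  then show ?case using braid_equiv.braid_swap'[of i "a @ c" "d @ b"] by simp
next
  case (far_swap i j c d)
  then show ?case using braid_equiv.far_swap[of i j "a @ c" "d @ b"] by simp
qed (auto intro: braid_refl braid_trans)

lemma braid_equiv_Cons: "x \<sim> y \<Longrightarrow> i # x \<sim> i # y"
  using braid_equiv_append[of x y "[i]" "[]"] by simp

lemma braid_equiv_length: "x \<sim> y \<Longrightarrow> length x = length y"
  by (induction rule: braid_equiv.induct) auto

lemma braid_equiv_set: "x \<sim> y \<Longrightarrow> set x = set y"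
  by (induction rule: braid_equiv.induct) auto

lemma perm_of_Nil [simp]: "perm_of [] = id"
  and perm_of_Cons: "perm_of (i # x) = transpose i (Suc i) \<circ> perm_of x"
  by (simp_all add: perm_of_def)

lemma perm_of_append: "perm_of (x @ y) = perm_of x \<circ> perm_of y"
  by (induction x) (auto simp: perm_of_Cons o_assoc)

lemma braid_equiv_perm_of: "x \<sim> y \<Longrightarrow> perm_of x = perm_of y"
proof (induction rule: braid_equiv.induct)
  case (braid_swap i a b)
  have "perm_of [i, Suc i, i] = perm_of [Suc i, i, Suc i]"
    by (auto simp: perm_of_Cons fun_eq_iff transpose_def)
  then show ?case unfolding perm_of_append by simp
next
  case (braid_swap' i a b)
  have "perm_of [i, Suc i, i] = perm_of [Suc i, i, Suc i]"
    by (auto simp: perm_of_Cons fun_eq_iff transpose_def)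
  then show ?case unfolding perm_of_append by simp
next
  case (far_swap i j a b)
  then have "perm_of [i, j] = perm_of [j, i]"
    by (auto simp: perm_of_Cons fun_eq_iff transpose_def)
  then show ?case unfolding perm_of_append by simp
qed auto

lemma perm_of_rev_cancel: "perm_of (rev x) \<circ> perm_of x = id"
proof (induction x)
  case (Cons i x)
  then show ?case by (simp add: fun_eq_iff perm_of_append perm_of_Cons)
qed simp

lemma perm_of_rev: "perm_of (rev x) = inv_into UNIV (perm_of x)"
  using perm_of_rev_cancel[of "rev x"] perm_of_rev_cancel[of x]
  by (metis inv_unique_comp rev_rev_ident)

lemma perm_of_permutes: "set x \<subseteq> {a..<b} \<Longrightarrow> perm_of x permutes {a..b}"
proof (induction x)
  case (Cons i x)
  then have "transpose i (Suc i) permutes {a..b}" by (intro permutes_swap_id) auto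
  with Cons show ?case unfolding perm_of_Cons by (intro permutes_compose) auto
qed (auto simp: permutes_id)

lemma far_shift:
  "\<forall>k\<in>set y. Suc i < k \<or> Suc k < i \<Longrightarrow> i # y \<sim> y @ [i]"
proof (induction y)
  case (Cons k y)
  have "i # k # y \<sim> k # i # y"
    using braid_equiv.far_swap[of i k "[]" y] Cons.prems by auto
  moreover have "k # i # y \<sim> k # (y @ [i])"
    using Cons by (intro braid_equiv_Cons) auto
  ultimately show ?case by (auto intro: braid_trans)
qed (simp add: braid_refl)

text \<open>
  A letter \<open>i\<close> can be moved through the chain: it commutes with the letters up to \<open>i - 2\<close>, then
  a single braid move turns \<open>i, i - 1, i\<close> into \<open>i - 1, i, i - 1\<close>, and the new letter \<open>i - 1\<close>
  commutes with the rest.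
\<close>

lemma chain_shift:
  assumes "0 < j" "j < i" "i \<le> m"
  shows "i # [j..<Suc m] \<sim> [j..<Suc m] @ [i - 1]"
proof -
  obtain k where i: "i = Suc k" using assms by (cases i) auto
  have split: "[j..<Suc m] = [j..<k] @ [k, Suc k] @ [Suc (Suc k)..<Suc m]"
  proof -
    have "[j..<Suc m] = [j..<k] @ [k..<Suc m]"
      using assms i upt_add_eq_append[of j k "Suc m - k"] by simp
    also have "[k..<Suc m] = k # Suc k # [Suc (Suc k)..<Suc m]"
      using assms i by (simp add: upt_conv_Cons)
    finally show ?thesis by simp
  qed
  let ?b = "[Suc (Suc k)..<Suc m]"
  have "i # [j..<k] \<sim> [j..<k] @ [i]" using assms i by (intro far_shift) auto
  from braid_equiv_append[OF this, of "[]" "[k, Suc k] @ ?b"]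
  have 1: "i # [j..<Suc m] \<sim> [j..<k] @ [Suc k, k, Suc k] @ ?b"
    unfolding split by (simp add: i)
  have 2: "[j..<k] @ [Suc k, k, Suc k] @ ?b \<sim> [j..<k] @ [k, Suc k, k] @ ?b"
    using assms i by (intro braid_swap') auto
  have "k # ?b \<sim> ?b @ [k]" by (intro far_shift) auto
  from braid_equiv_append[OF this, of "[j..<k] @ [k, Suc k]" "[]"]
  have 3: "[j..<k] @ [k, Suc k, k] @ ?b \<sim> [j..<Suc m] @ [k]" unfolding split by simp
  have "i - 1 = k" using i by simp
  then show ?thesis using braid_trans[OF 1 braid_trans[OF 2 3]] by simp
qed

text \<open>
  The chain in front is the minimal representative of a coset of $S_m$ in $S_{m+1}$, determined by
  the image \<open>j\<close> of \<open>m + 1\<close>; the rest describes an element of $S_m$. So there is one normal word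
  for each permutation.
\<close>

fun normal_words :: "nat \<Rightarrow> nat list set" where
  "normal_words 0 = {[]}"
| "normal_words (Suc m) = {[j..<Suc m] @ v | j v. 1 \<le> j \<and> j \<le> Suc m \<and> v \<in> normal_words m}"

lemma Nil_in_normal_words: "[] \<in> normal_words m"
  by (induction m) force+

lemma normal_words_letters: "x \<in> normal_words m \<Longrightarrow> set x \<subseteq> {1..<m}"
  by (induction m arbitrary: x) fastforce+

text \<open>
  This is the exchange property: up to braid moves, left multiplication by a letter either
  lengthens a normal word to a normal word, or undoes such a lengthening. With a chain starting at
  \<open>j\<close> in front, the letter \<open>i\<close> passes through the chain if \<open>i < j - 1\<close> or \<open>i > j\<close>, extends it
  if \<open>i = j - 1\<close>, and shortens it if \<open>i = j\<close>.
\<close>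

lemma normal_words_step:
  assumes "x \<in> normal_words m" "1 \<le> i" "i < m"
  shows "\<exists>y\<in>normal_words m. i # x \<sim> y \<or> i # y \<sim> x"
  using assms
proof (induction m arbitrary: x i)
  case (Suc m)
  from Suc.prems obtain j v where x: "x = [j..<Suc m] @ v" "1 \<le> j" "j \<le> Suc m" "v \<in> normal_words m"
    by auto
  have move: ?case if "i # [j..<Suc m] \<sim> [j..<Suc m] @ [k]" "1 \<le> k" "k < m" for k
  proof -
    from Suc.IH[OF x(4) that(2,3)] obtain y where
      y: "y \<in> normal_words m" "k # v \<sim> y \<or> k # y \<sim> v" by blast
    have *: "i # [j..<Suc m] @ w \<sim> [j..<Suc m] @ k # w" for w
      using braid_equiv_append[OF that(1), of "[]" w] by simp
    have "i # x \<sim> [j..<Suc m] @ y \<or> i # [j..<Suc m] @ y \<sim> x"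
      using y(2) *[of v] *[of y] braid_equiv_append[of "k # v" y "[j..<Suc m]" "[]"]
        braid_equiv_append[of "k # y" v "[j..<Suc m]" "[]"]
      unfolding x(1) by (auto intro: braid_trans)
    moreover have "[j..<Suc m] @ y \<in> normal_words (Suc m)" using x y by auto
    ultimately show ?thesis by blast
  qed
  consider "i < j - 1" | "i = j - 1" | "i = j" | "j < i" by linarith
  then show ?case
  proof cases
    case 1
    then show ?thesis using Suc.prems x by (intro move[of i] far_shift) auto
  next
    case 2
    then have j: "j = Suc i" using Suc.prems x(2) by simp
    have "i # x = [i..<Suc m] @ v"
      unfolding x(1) j using Suc.prems by (simp add: upt_conv_Cons[of i] del: upt_Suc)
    moreover have "[i..<Suc m] @ v \<in> normal_words (Suc m)"
      using Suc.prems x 2 by fastforce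
    ultimately show ?thesis using braid_refl by metis
  next
    case 3
    then have "i # ([Suc i..<Suc m] @ v) = x"
      using Suc.prems x by (simp add: upt_conv_Cons del: upt_Suc)
    moreover have "[Suc i..<Suc m] @ v \<in> normal_words (Suc m)"
      using Suc.prems x by fastforce
    ultimately show ?thesis using braid_refl by metis
  next
    case 4
    then show ?thesis using Suc.prems x by (intro move[of "i - 1"] chain_shift) auto
  qed
qed simp

lemma perm_of_chain_last: "j \<le> Suc m \<Longrightarrow> perm_of [j..<Suc m] (Suc m) = j"
proof (induction "Suc m - j" arbitrary: j)
  case (Suc d)
  then have "perm_of [Suc j..<Suc m] (Suc m) = Suc j" by auto
  moreover have "j < Suc m" using Suc by simp
  ultimately show ?case by (simp add: upt_conv_Cons perm_of_Cons del: upt_Suc)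
qed simp

lemma perm_of_inj: "inj (perm_of x)"
  by (metis inj_on_id inj_on_imageI2 perm_of_rev_cancel)

lemma normal_words_unique:
  "x \<in> normal_words m \<Longrightarrow> y \<in> normal_words m \<Longrightarrow> perm_of x = perm_of y \<Longrightarrow> x = y"
proof (induction m arbitrary: x y)
  case (Suc m)
  obtain j v where x: "x = [j..<Suc m] @ v" "1 \<le> j" "j \<le> Suc m" "v \<in> normal_words m"
    using Suc.prems by auto
  obtain k w where y: "y = [k..<Suc m] @ w" "1 \<le> k" "k \<le> Suc m" "w \<in> normal_words m"
    using Suc.prems by auto
  have fixed: "perm_of u (Suc m) = Suc m" if "u \<in> normal_words m" for u
    using perm_of_permutes[of u 1 m] normal_words_letters[OF that]
    by (auto simp: permutes_def)
  have "perm_of x (Suc m) = j" "perm_of y (Suc m) = k"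
    using perm_of_chain_last x(3) y(3) fixed[OF x(4)] fixed[OF y(4)]
    unfolding x(1) y(1) perm_of_append by simp_all
  then have jk: "j = k" using Suc.prems by simp
  have "perm_of v = perm_of w"
    using Suc.prems(3) perm_of_inj[of "[j..<Suc m]"] unfolding x(1) y(1) jk perm_of_append
    by (simp add: inj_def fun_eq_iff del: upt_Suc)
  then show ?case using Suc.IH x y jk by simp
qed simp

text \<open>
  Reading a word from the right and keeping track of the normal word of the permutation, each
  letter either prolongs the normal word (and braid equivalence is kept) or shortens it (and a
  gap in length arises, which never closes again).
\<close>

lemma normal_word_shortest:
  assumes "set x \<subseteq> {1..<m}"
  shows "\<exists>y\<in>normal_words m. perm_of y = perm_of x \<and>
    (length y < length x \<or> x \<sim> y)"
  using assms
proof (induction x)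
  case Nil
  then show ?case using Nil_in_normal_words braid_refl by fastforce
next
  case (Cons i x)
  then obtain y where y: "y \<in> normal_words m" "perm_of y = perm_of x"
    "length y < length x \<or> x \<sim> y" by auto
  have le: "length y \<le> length x" using y(3) braid_equiv_length by fastforce
  obtain z where z: "z \<in> normal_words m" "i # y \<sim> z \<or> i # z \<sim> y"
    using normal_words_step[OF y(1), of i] Cons.prems by auto
  show ?case
  proof (cases "i # y \<sim> z")
    case True
    have "perm_of z = perm_of (i # x)"
      using braid_equiv_perm_of[OF True] y(2) by (simp add: perm_of_Cons)
    moreover have "length z < length (i # x) \<or> i # x \<sim> z"
      using y(3) True braid_equiv_length[OF True] braid_equiv_Cons[of x y i]
      by (auto intro: braid_trans)
    ultimately show ?thesis using z by auto
  next
    case False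
    then have *: "i # z \<sim> y" using z by simp
    have "transpose i (Suc i) \<circ> perm_of z = perm_of x"
      using braid_equiv_perm_of[OF *] y(2) by (simp add: perm_of_Cons)
    then have "perm_of z = perm_of (i # x)"
      by (metis comp_id id_o o_assoc perm_of_Cons transpose_comp_involutory)
    moreover have "length z < length (i # x)"
      using braid_equiv_length[OF *] le by simp
    ultimately show ?thesis using z by auto
  qed
qed

lemma expression_exists:
  "w permutes {a..m} \<Longrightarrow> 1 \<le> a \<Longrightarrow> \<exists>x\<in>normal_words m. perm_of x = w \<and> set x \<subseteq> {a..<m}"
proof (induction m arbitrary: w)
  case 0
  then show ?case by auto
next
  case (Suc m)
  show ?case
  proof (cases "a \<le> Suc m")
    case False
    then have "w = id" using Suc.prems by simp
    then show ?thesis using Nil_in_normal_words[of "Suc m"] by (intro bexI[of _ "[]"]) simp_all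
  next
    case True
    define j where "j = w (Suc m)"
    have j: "a \<le> j" "j \<le> Suc m"
      using permutes_in_image[OF Suc.prems(1), of "Suc m"] True by (auto simp: j_def)
    define v where "v = perm_of (rev [j..<Suc m]) \<circ> w"
    have w: "w = perm_of [j..<Suc m] \<circ> v"
      unfolding v_def o_assoc using perm_of_rev_cancel[of "rev [j..<Suc m]"] by simp
    have v: "v permutes {a..Suc m}"
      unfolding v_def using j
      by (intro permutes_compose[OF Suc.prems(1)] perm_of_permutes) auto
    have "v (Suc m) = Suc m"
      using perm_of_rev_cancel[of "[j..<Suc m]"] perm_of_chain_last[OF j(2)]
      by (metis comp_apply id_apply j_def v_def)
    then have "v permutes {a..m}"
      using v by (auto simp: permutes_def) (metis le_SucE)
    then obtain x where "x \<in> normal_words m" "perm_of x = v" "set x \<subseteq> {a..<m}"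
      using Suc.IH Suc.prems(2) by blast
    moreover from this have "[j..<Suc m] @ x \<in> normal_words (Suc m)"
      using j Suc.prems(2) by fastforce
    ultimately show ?thesis using w j
      by (intro bexI[of _ "[j..<Suc m] @ x"]) (auto simp: perm_of_append simp del: upt_Suc)
  qed
qed

lemma normal_word_reduced:
  assumes "y \<in> normal_words n"
  shows "reduced n (perm_of y) y"
proof -
  have y: "expression n (perm_of y) y"
    using normal_words_letters[OF assms] by (auto simp: expression_def)
  have "length y \<le> length x" if "expression n (perm_of y) x" for x
  proof -
    have x: "set x \<subseteq> {1..<n}" "perm_of x = perm_of y" using that by (auto simp: expression_def)
    obtain z where "z \<in> normal_words n" "perm_of z = perm_of x" "length z < length x \<or> x \<sim> z"
      using normal_word_shortest[OF x(1)] by blast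
    then show ?thesis
      using normal_words_unique[OF assms, of z] x(2) braid_equiv_length by fastforce
  qed
  then have "len n (perm_of y) = length y"
    unfolding len_def using y by (intro Least_equality) auto
  then show ?thesis using y by (simp add: reduced_def)
qed

text \<open>
  Both words are braid equivalent to the normal word, since they are as short as it is.
\<close>

theorem matsumoto:
  assumes "reduced n w x" "reduced n w y"
  shows "x \<sim> y"
proof -
  have "\<exists>z\<in>normal_words n. perm_of z = w \<and> u \<sim> z" if "reduced n w u" for u
  proof -
    have u: "set u \<subseteq> {1..<n}" "perm_of u = w" "length u = len n w"
      using that by (auto simp: reduced_def expression_def)
    obtain z where z: "z \<in> normal_words n" "perm_of z = w" "length z < length u \<or> u \<sim> z"
      using normal_word_shortest[OF u(1)] u(2) by auto
    then show ?thesis using normal_word_reduced[OF z(1)] u(3) by (auto simp: reduced_def)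
  qed
  then show ?thesis
    using assms normal_words_unique braid_trans braid_equiv_sym by metis
qed

lemma reduced_exists:
  assumes "w permutes {1..n}" shows "\<exists>x. reduced n w x"
  using expression_exists[OF assms] normal_word_reduced by blast

lemma perms_eq_perm_of:
  assumes "1 \<le> a"
  shows "{v. v permutes {a..b}} = perm_of ` {x. set x \<subseteq> {a..<b}}"
  using expression_exists[OF _ assms] perm_of_permutes by blast

text \<open>
  The letters below \<open>r\<close> commute with those above \<open>r\<close>, so they can be collected on the left.
\<close>

lemma split_far_letters:
  assumes "set x \<subseteq> {1..<r} \<union> {r+1..<n}"
  shows "\<exists>a b. set a \<subseteq> {1..<r} \<and> set b \<subseteq> {r+1..<n} \<and> x \<sim> a @ b"
  using assms
proof (induction x)
  case Nil
  then show ?case using braid_refl by fastforce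
next
  case (Cons i x)
  then obtain a b where ab: "set a \<subseteq> {1..<r}" "set b \<subseteq> {r+1..<n}" "x \<sim> a @ b" by auto
  from braid_equiv_Cons[OF ab(3)] have ix: "i # x \<sim> i # a @ b" .
  show ?case
  proof (cases "i < r")
    case True
    then show ?thesis using Cons.prems ab ix by (intro exI[of _ "i # a"] exI[of _ b]) auto
  next
    case False
    then have "i # a \<sim> a @ [i]" using ab(1) Cons.prems by (intro far_shift) auto
    from braid_equiv_append[OF this, of "[]" b] have "i # a @ b \<sim> a @ i # b" by simp
    then have "i # x \<sim> a @ i # b" using ix braid_trans by blast
    then show ?thesis using Cons.prems ab False by (intro exI[of _ a] exI[of _ "i # b"]) auto
  qed
qed

lemma parabolic_eq_perm_of:
  "{v \<circ> v' | v v'. v permutes {1..r} \<and> v' permutes {r+1..n}}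
    = perm_of ` {x. set x \<subseteq> {1..<r} \<union> {r+1..<n}}" (is "?P = ?Q")
proof
  show "?P \<subseteq> ?Q"
  proof
    fix u assume "u \<in> ?P"
    then obtain v v' where u: "u = v \<circ> v'" "v permutes {1..r}" "v' permutes {r+1..n}" by blast
    obtain x where x: "perm_of x = v" "set x \<subseteq> {1..<r}"
      using expression_exists[OF u(2)] by auto
    obtain y where y: "perm_of y = v'" "set y \<subseteq> {r+1..<n}"
      using expression_exists[OF u(3)] by auto
    have "u = perm_of (x @ y)" "set (x @ y) \<subseteq> {1..<r} \<union> {r+1..<n}"
      using u x y by (auto simp: perm_of_append)
    then show "u \<in> ?Q" by blast
  qed
  show "?Q \<subseteq> ?P"
  proof
    fix u assume "u \<in> ?Q"
    then obtain x where x: "u = perm_of x" "set x \<subseteq> {1..<r} \<union> {r+1..<n}" by blast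
    obtain a b where ab: "set a \<subseteq> {1..<r}" "set b \<subseteq> {r+1..<n}" "x \<sim> a @ b"
      using split_far_letters[OF x(2)] by blast
    have "u = perm_of a \<circ> perm_of b"
      using braid_equiv_perm_of[OF ab(3)] x(1) by (simp add: perm_of_append)
    then show "u \<in> ?P" using perm_of_permutes[OF ab(1)] perm_of_permutes[OF ab(2)] by blast
  qed
qed

lemma reduced_rev:
  assumes "reduced n w x"
  shows "reduced n (inv_into UNIV w) (rev x)"
proof -
  have *: "expression n (inv_into UNIV u) (rev y)" if "expression n u y" for u y
    using that perm_of_rev[of y] by (auto simp: expression_def)
  have x: "expression n w x" "length x = len n w" using assms by (auto simp: reduced_def)
  have "length x \<le> length y" if "expression n (inv_into UNIV w) y" for y
  proof -
    have "inv_into UNIV (inv_into UNIV w) = w" using x(1) perm_of_rev[of x] perm_of_rev[of "rev x"]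
      by (auto simp: expression_def)
    then have "expression n w (rev y)" using *[OF that] by simp
    then have "len n w \<le> length (rev y)" unfolding len_def by (intro Least_le) auto
    then show ?thesis using x(2) by simp
  qed
  then have "len n (inv_into UNIV w) = length (rev x)"
    unfolding len_def using *[OF x(1)] by (intro Least_equality) auto
  then show ?thesis using *[OF x(1)] by (auto simp: reduced_def)
qed

text \<open>
  Right multiplication by a simple reflection changes the length by one. This is
  \<open>normal_words_step\<close> for the inverse of \<open>w\<close>, read backwards.
\<close>

lemma reduced_step_right:
  assumes "w permutes {1..n}" "1 \<le> i" "i < n"
  shows "\<exists>x. (reduced n w x \<and> reduced n (w \<circ> transpose i (Suc i)) (x @ [i])) \<or>
    (reduced n (w \<circ> transpose i (Suc i)) x \<and> reduced n w (x @ [i]))"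
proof -
  obtain x where x: "x \<in> normal_words n" "perm_of x = inv_into UNIV w"
    using expression_exists[OF permutes_inv[OF assms(1)]] by auto
  obtain y where y: "y \<in> normal_words n" "i # x \<sim> y \<or> i # y \<sim> x"
    using normal_words_step[OF x(1) assms(2,3)] by blast
  have tt: "transpose i (Suc i) \<circ> (transpose i (Suc i) \<circ> f) = f" for f :: "nat \<Rightarrow> nat"
    by (simp add: o_assoc)
  have perm_y: "perm_of y = transpose i (Suc i) \<circ> inv_into UNIV w"
    using y(2) braid_equiv_perm_of[of "i # x" y] braid_equiv_perm_of[of "i # y" x] x(2)
      tt[of "perm_of y"]
    by (auto simp: perm_of_Cons)
  have inv_w: "inv_into UNIV (inv_into UNIV w) = w" using permutes_inv_inv[OF assms(1)] .
  have "inv_into UNIV (transpose i (Suc i) \<circ> inv_into UNIV w) = w \<circ> transpose i (Suc i)"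
    using o_inv_distrib[of "transpose i (Suc i)" "inv_into UNIV w"] permutes_bij[OF permutes_inv[OF assms(1)]]
    by (simp add: inv_w)
  then have inv_y: "inv_into UNIV (perm_of y) = w \<circ> transpose i (Suc i)" by (simp add: perm_y)
  have rev_red: "reduced n (inv_into UNIV (perm_of z)) (rev z)" if "z \<in> normal_words n" for z
    using reduced_rev normal_word_reduced that by blast
  have red_Cons: "reduced n (inv_into UNIV (perm_of b)) (rev a @ [i])"
    if "i # a \<sim> b" "b \<in> normal_words n" for a b
  proof -
    have "reduced n (perm_of b) (i # a)"
      using normal_word_reduced[OF that(2)] braid_equiv_length[OF that(1)]
        braid_equiv_set[OF that(1)] braid_equiv_perm_of[OF that(1)]
      by (auto simp: reduced_def expression_def)
    from reduced_rev[OF this] show ?thesis by simp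
  qed
  from y(2) show ?thesis
  proof
    assume "i # x \<sim> y"
    from red_Cons[OF this y(1)] rev_red[OF x(1)] show ?thesis
      by (auto simp: inv_y x(2) inv_w)
  next
    assume "i # y \<sim> x"
    from red_Cons[OF this x(1)] rev_red[OF y(1)] show ?thesis
      by (auto simp: inv_y x(2) inv_w)
  qed
qed

lemma reduced_letters: "reduced n w x \<Longrightarrow> set x \<subseteq> {1..<n}"
  by (simp add: reduced_def expression_def)

section \<open>Linear algebra modulo an ideal\<close>

text \<open>
  The quotient by \<open>K\<close> is not formed. Its elements are represented up to congruence, and its
  subspaces by the subspaces that contain \<open>K\<close>, so that the arithmetic of the ambient ring can be
  used without side conditions on membership.
\<close>

locale algebra_mod_ideal = vector_space scale
  for scale :: "'k::field \<Rightarrow> 'a::ring_1 \<Rightarrow> 'a" (infixr "*s" 75) +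
  fixes K :: "'a set"
  assumes scale_mult_left: "(c *s x) * y = c *s (x * y)"
    and scale_mult_right: "x * (c *s y) = c *s (x * y)"
    and subspace_ideal: "subspace K"
    and ideal_mult_left: "x \<in> K \<Longrightarrow> y * x \<in> K"
    and ideal_mult_right: "x \<in> K \<Longrightarrow> x * y \<in> K"
begin

definition cong :: "'a \<Rightarrow> 'a \<Rightarrow> bool" (infix "\<asymp>" 50)
  where "x \<asymp> y \<longleftrightarrow> x - y \<in> K"

definition cspan :: "'a set \<Rightarrow> 'a set"
  where "cspan S = span (S \<union> K)"

lemma cong_refl [simp]: "x \<asymp> x"
  by (simp add: cong_def subspace_0 subspace_ideal)

lemma cong_sym: "x \<asymp> y \<Longrightarrow> y \<asymp> x"
  using subspace_neg[OF subspace_ideal] by (force simp: cong_def)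

lemma cong_trans [trans]: "x \<asymp> y \<Longrightarrow> y \<asymp> z \<Longrightarrow> x \<asymp> z"
  using subspace_add[OF subspace_ideal, of "x - y" "y - z"] by (simp add: cong_def)

lemma cong_add: "x \<asymp> y \<Longrightarrow> x' \<asymp> y' \<Longrightarrow> x + x' \<asymp> y + y'"
  using subspace_add[OF subspace_ideal, of "x - y" "x' - y'"] by (simp add: cong_def algebra_simps)

lemma cong_diff: "x \<asymp> y \<Longrightarrow> x' \<asymp> y' \<Longrightarrow> x - x' \<asymp> y - y'"
  using subspace_diff[OF subspace_ideal, of "x - y" "x' - y'"] by (simp add: cong_def algebra_simps)

lemma cong_scale: "x \<asymp> y \<Longrightarrow> c *s x \<asymp> c *s y"
  using subspace_scale[OF subspace_ideal, of "x - y" c]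
  by (simp add: cong_def scale_right_diff_distrib)

lemma cong_mult_left: "x \<asymp> y \<Longrightarrow> a * x \<asymp> a * y"
  using ideal_mult_left[of "x - y" a] by (simp add: cong_def algebra_simps)

lemma cong_mult_right: "x \<asymp> y \<Longrightarrow> x * a \<asymp> y * a"
  using ideal_mult_right[of "x - y" a] by (simp add: cong_def algebra_simps)

lemma cspan_base: "x \<in> S \<Longrightarrow> x \<in> cspan S"
  and ideal_in_cspan: "x \<in> K \<Longrightarrow> x \<in> cspan S"
  and cspan_zero: "0 \<in> cspan S"
  and cspan_add: "x \<in> cspan S \<Longrightarrow> y \<in> cspan S \<Longrightarrow> x + y \<in> cspan S"
  and cspan_diff: "x \<in> cspan S \<Longrightarrow> y \<in> cspan S \<Longrightarrow> x - y \<in> cspan S"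
  and cspan_scale: "x \<in> cspan S \<Longrightarrow> c *s x \<in> cspan S"
  and subspace_cspan: "subspace (cspan S)"
  by (auto simp: cspan_def span_base span_zero intro: span_add span_diff span_scale)

lemma cspan_subset: "S \<subseteq> cspan T \<Longrightarrow> cspan S \<subseteq> cspan T"
  unfolding cspan_def by (intro span_minimal) (auto intro: span_base)

lemma cspan_mono: "S \<subseteq> T \<Longrightarrow> cspan S \<subseteq> cspan T"
  by (intro cspan_subset) (auto intro: cspan_base)

lemma cspan_eqI: "S \<subseteq> cspan T \<Longrightarrow> T \<subseteq> cspan S \<Longrightarrow> cspan S = cspan T"
  by (intro equalityI cspan_subset)

lemma cspan_cong_mem: "x \<asymp> y \<Longrightarrow> y \<in> cspan S \<Longrightarrow> x \<in> cspan S"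
  using cspan_add[OF ideal_in_cspan[of "x - y"], of y] by (simp add: cong_def)

lemma cspan_eq_of_cong:
  assumes "\<And>x. x \<in> S \<Longrightarrow> \<exists>y\<in>T. x \<asymp> y" "\<And>y. y \<in> T \<Longrightarrow> \<exists>x\<in>S. y \<asymp> x"
  shows "cspan S = cspan T"
  using assms by (intro cspan_eqI) (blast intro: cspan_cong_mem cspan_base)+

lemma cspan_sandwich:
  assumes "x \<in> cspan S" "\<And>s. s \<in> S \<Longrightarrow> a * s * b \<in> cspan T"
  shows "a * x * b \<in> cspan T"
proof -
  have "subspace {x. a * x * b \<in> cspan T}"
    by (intro subspaceI)
      (auto simp: distrib_left distrib_right scale_mult_left scale_mult_right
        intro: cspan_zero cspan_add cspan_scale)
  moreover have "S \<union> K \<subseteq> {x. a * x * b \<in> cspan T}"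
    using assms(2) by (auto intro: ideal_in_cspan ideal_mult_left ideal_mult_right)
  ultimately show ?thesis using assms(1) span_minimal unfolding cspan_def by blast
qed

lemma cspan_left:
  assumes "x \<in> cspan S" "\<And>s. s \<in> S \<Longrightarrow> a * s \<in> cspan T"
  shows "a * x \<in> cspan T"
  using cspan_sandwich[OF assms(1), of a 1 T] assms(2) by simp

lemma cspan_right:
  assumes "x \<in> cspan S" "\<And>s. s \<in> S \<Longrightarrow> s * b \<in> cspan T"
  shows "x * b \<in> cspan T"
  using cspan_sandwich[OF assms(1), of 1 b T] assms(2) by simp

lemma cspan_mult:
  assumes "x \<in> cspan S" "y \<in> cspan T"
  shows "x * y \<in> cspan (S * T)"
  by (rule cspan_right[OF assms(1)], rule cspan_left[OF assms(2)]) (auto intro: cspan_base)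

text \<open>
  Factors in a product of spanning sets may be replaced one by one. All later factorizations of
  $H_ne_{(r)}H_n$ are chains of such replacements.
\<close>

lemma cspan_times_cong:
  assumes "cspan S = cspan S'" "cspan T = cspan T'"
  shows "cspan (S * T) = cspan (S' * T')"
proof (rule cspan_eqI)
  show "S * T \<subseteq> cspan (S' * T')"
    using assms by (auto elim!: set_times_elim intro!: cspan_mult intro: cspan_base)
  show "S' * T' \<subseteq> cspan (S * T)"
    using assms by (auto elim!: set_times_elim intro!: cspan_mult) (auto intro: cspan_base)
qed

lemma cspan_commute:
  assumes "\<And>x y. x \<in> S \<Longrightarrow> y \<in> T \<Longrightarrow> x * y \<asymp> y * x"
  shows "cspan (S * T) = cspan (T * S)"
  using assms by (intro cspan_eq_of_cong) (blast elim!: set_times_elim intro: set_times_intro cong_sym)+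

end

section \<open>The Hecke algebra modulo an ideal\<close>

locale hecke_mod_ideal = algebra_mod_ideal scale K
  for scale :: "'k::field \<Rightarrow> 'a::ring_1 \<Rightarrow> 'a" (infixr "*s" 75) and K +
  fixes n :: nat and z :: 'k and g :: "nat \<Rightarrow> 'a"
  assumes hecke_braid: "1 \<le> i \<Longrightarrow> Suc i < n \<Longrightarrow> g i * g (Suc i) * g i \<asymp> g (Suc i) * g i * g (Suc i)"
    and hecke_far: "1 \<le> i \<Longrightarrow> Suc i < j \<Longrightarrow> j < n \<Longrightarrow> g i * g j \<asymp> g j * g i"
    and hecke_quadratic: "1 \<le> i \<Longrightarrow> i < n \<Longrightarrow> g i * g i \<asymp> z *s g i + 1"
begin

definition g_word :: "nat list \<Rightarrow> 'a" where "g_word x = prod_list (map g x)"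

text \<open>
  This set contains \<open>1\<close> and is closed under products, so that its \<open>cspan\<close> is the sum of \<open>K\<close>
  and the subalgebra generated by the $g_i$ with \<open>i\<close> in \<open>J\<close>.
\<close>

definition monomials :: "nat set \<Rightarrow> 'a set" where "monomials J = g_word ` {x. set x \<subseteq> J}"

definition h_perm :: "(nat \<Rightarrow> nat) \<Rightarrow> 'a" where "h_perm w = g_word (SOME x. reduced n w x)"

lemma g_word_simps [simp]: "g_word [] = 1" "g_word (i # x) = g i * g_word x" "g_word (x @ y) = g_word x * g_word y"
  by (simp_all add: g_word_def)

lemma g_word_in_monomials: "set x \<subseteq> J \<Longrightarrow> g_word x \<in> monomials J"
  by (auto simp: monomials_def)

lemma one_in_monomials: "1 \<in> monomials J"
  using g_word_in_monomials[of "[]" J] by simp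

lemma gen_in_monomials: "i \<in> J \<Longrightarrow> g i \<in> monomials J"
  using g_word_in_monomials[of "[i]" J] by simp

lemma monomials_subset: "J \<subseteq> J' \<Longrightarrow> monomials J \<subseteq> monomials J'"
  by (auto simp: monomials_def)

lemma monomials_mult: "x \<in> monomials J \<Longrightarrow> y \<in> monomials J \<Longrightarrow> x * y \<in> monomials J"
  unfolding monomials_def by (auto simp flip: g_word_simps(3))

lemma monomials_empty: "monomials {} = {1}"
  by (auto simp: monomials_def)

lemma g_word_braid_equiv: "x \<sim> y \<Longrightarrow> set x \<subseteq> {1..<n} \<Longrightarrow> g_word x \<asymp> g_word y"
proof (induction rule: braid_equiv.induct)
  case (braid_trans x y u)
  then show ?case using braid_equiv_set[of x y] cong_trans by auto
next
  case (braid_swap i a b)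
  then have "g i * g (Suc i) * g i \<asymp> g (Suc i) * g i * g (Suc i)" by (intro hecke_braid) auto
  from cong_mult_left[OF cong_mult_right[OF this, of "g_word b"], of "g_word a"]
  show ?case by (simp add: mult.assoc)
next
  case (braid_swap' i a b)
  then have "g i * g (Suc i) * g i \<asymp> g (Suc i) * g i * g (Suc i)" by (intro hecke_braid) auto
  from cong_mult_left[OF cong_mult_right[OF cong_sym[OF this], of "g_word b"], of "g_word a"]
  show ?case by (simp add: mult.assoc)
next
  case (far_swap i j a b)
  then have "g i * g j \<asymp> g j * g i"
    using hecke_far[of i j] cong_sym[OF hecke_far[of j i]] by auto
  from cong_mult_left[OF cong_mult_right[OF this, of "g_word b"], of "g_word a"]
  show ?case by (simp add: mult.assoc)
qed simp

lemma cong_commute_g_word: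
  assumes "\<And>i. i \<in> set x \<Longrightarrow> y * g i \<asymp> g i * y"
  shows "y * g_word x \<asymp> g_word x * y"
  using assms
proof (induction x)
  case (Cons i x)
  have "y * g_word (i # x) \<asymp> (g i * y) * g_word x"
    using cong_mult_right[OF Cons.prems[of i], of "g_word x"] by (simp add: mult.assoc)
  also have "\<dots> \<asymp> g_word (i # x) * y"
    using cong_mult_left[of "y * g_word x" "g_word x * y" "g i"] Cons by (simp add: mult.assoc)
  finally show ?case .
qed simp

lemma gen_commute_monomials:
  assumes "a \<in> monomials J" "1 \<le> i" "i < n" "J \<subseteq> {1..<n}" "\<And>j. j \<in> J \<Longrightarrow> Suc i < j \<or> Suc j < i"
  shows "g i * a \<asymp> a * g i"
proof -
  from assms(1) obtain x where x: "a = g_word x" "set x \<subseteq> J" by (auto simp: monomials_def)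
  have "g i * g j \<asymp> g j * g i" if "j \<in> set x" for j
    using hecke_far[of i j] cong_sym[OF hecke_far[of j i]] assms(2-5) x that by fastforce
  then show ?thesis unfolding x by (rule cong_commute_g_word)
qed

lemma gen_square_absorb:
  assumes "1 \<le> i" "i < n" shows "g i * (g i * x) \<asymp> z *s (g i * x) + x"
  using cong_mult_right[OF hecke_quadratic[OF assms], of x]
  by (simp add: mult.assoc distrib_right scale_mult_left)

text \<open>
  By the exchange property $g_i$ times a normal monomial is again normal, or it is $g_i^2$ times a
  normal monomial, which the quadratic relation reduces.
\<close>

lemma cspan_monomials_eq_normal:
  assumes "m \<le> n"
  shows "cspan (monomials {1..<m}) = cspan (g_word ` normal_words m)"
proof (rule cspan_eqI)
  show "g_word ` normal_words m \<subseteq> cspan (monomials {1..<m})"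
    using normal_words_letters by (fastforce intro: cspan_base g_word_in_monomials)
  have "g_word x \<in> cspan (g_word ` normal_words m)" if "set x \<subseteq> {1..<m}" for x
    using that
  proof (induction x)
    case Nil
    then show ?case using imageI[OF Nil_in_normal_words, of g_word m] by (auto intro: cspan_base)
  next
    case (Cons i x)
    have i: "1 \<le> i" "i < m" using Cons.prems by auto
    have "g i * s \<in> cspan (g_word ` normal_words m)" if s: "s \<in> g_word ` normal_words m" for s
    proof -
      from s obtain u where u: "u \<in> normal_words m" "s = g_word u" by auto
      then obtain v where v: "v \<in> normal_words m" "i # u \<sim> v \<or> i # v \<sim> u"
        using normal_words_step i by blast
      have uv: "g_word u \<in> cspan (g_word ` normal_words m)" "g_word v \<in> cspan (g_word ` normal_words m)"
        using u v by (auto intro: cspan_base)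
      have letters: "set u \<subseteq> {1..<n}" "set v \<subseteq> {1..<n}"
        using normal_words_letters[OF u(1)] normal_words_letters[OF v(1)] assms by auto
      from v(2) show ?thesis
      proof
        assume "i # u \<sim> v"
        then have "g_word (i # u) \<asymp> g_word v" using letters i assms by (intro g_word_braid_equiv) auto
        then show ?thesis using cspan_cong_mem uv(2) u(2) by simp
      next
        assume "i # v \<sim> u"
        then have *: "g i * g_word v \<asymp> g_word u"
          using g_word_braid_equiv[of "i # v" u] letters i assms by simp
        have "g i * g_word u \<asymp> g i * (g i * g_word v)" by (intro cong_mult_left cong_sym[OF *])
        also have "\<dots> \<asymp> z *s (g i * g_word v) + g_word v" using i assms by (intro gen_square_absorb) auto
        also have "\<dots> \<asymp> z *s g_word u + g_word v" using * by (intro cong_add cong_scale) auto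
        finally show ?thesis unfolding u(2)
          by (rule cspan_cong_mem) (intro cspan_add cspan_scale uv)
      qed
    qed
    then show ?case using cspan_left[of "g_word x"] Cons by auto
  qed
  then show "monomials {1..<m} \<subseteq> cspan (g_word ` normal_words m)" by (auto simp: monomials_def)
qed

lemma h_perm_reduced:
  assumes "reduced n w x" shows "h_perm w \<asymp> g_word x"
proof -
  have *: "reduced n w (SOME y. reduced n w y)" using someI assms by metis
  then show ?thesis
    unfolding h_perm_def using matsumoto[OF * assms] reduced_letters[OF *] by (intro g_word_braid_equiv)
qed

lemma h_perm_in_monomials: "w permutes {1..n} \<Longrightarrow> h_perm w \<in> monomials {1..<n}"
  unfolding h_perm_def using someI_ex[OF reduced_exists[of w n]]
  by (intro g_word_in_monomials reduced_letters)

lemma cspan_monomials_eq_h_perm: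
  "cspan (monomials {1..<n}) = cspan (h_perm ` {w. w permutes {1..n}})"
  unfolding cspan_monomials_eq_normal[OF order_refl]
proof (rule cspan_eq_of_cong)
  fix x assume "x \<in> g_word ` normal_words n"
  then obtain u where u: "u \<in> normal_words n" "x = g_word u" by blast
  then have "h_perm (perm_of u) \<asymp> x" using h_perm_reduced normal_word_reduced by blast
  moreover have "perm_of u permutes {1..n}"
    using normal_words_letters[OF u(1)] by (rule perm_of_permutes)
  ultimately show "\<exists>y\<in>h_perm ` {w. w permutes {1..n}}. x \<asymp> y" by (blast intro: cong_sym)
next
  fix y assume "y \<in> h_perm ` {w. w permutes {1..n}}"
  then obtain w where w: "w permutes {1..n}" "y = h_perm w" by blast
  then obtain u where "u \<in> normal_words n" "perm_of u = w" using expression_exists by blast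
  then show "\<exists>x\<in>g_word ` normal_words n. y \<asymp> x" using w h_perm_reduced normal_word_reduced by blast
qed

text \<open>
  If \<open>ws\<^sub>i\<close> is longer than \<open>w\<close>, then $h_{ws_i}=h_wg_i$. Otherwise $h_w=h_{ws_i}g_i$, and then
  $h_{ws_i}=h_wg_i^{-1}=h_wg_i-zh_w$.
\<close>

lemma h_perm_step:
  assumes "w permutes {1..n}" "1 \<le> i" "i < n"
  shows "\<exists>c d. h_perm (w \<circ> transpose i (Suc i)) \<asymp> c *s h_perm w + d *s (h_perm w * g i)"
proof -
  obtain x where "(reduced n w x \<and> reduced n (w \<circ> transpose i (Suc i)) (x @ [i])) \<or>
      (reduced n (w \<circ> transpose i (Suc i)) x \<and> reduced n w (x @ [i]))" (is "?A \<or> ?B")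
    using reduced_step_right[OF assms] by blast
  then show ?thesis
  proof
    assume ?A
    then have *: "h_perm w \<asymp> g_word x" "h_perm (w \<circ> transpose i (Suc i)) \<asymp> g_word (x @ [i])"
      by (auto intro: h_perm_reduced simp del: g_word_simps)
    have "h_perm (w \<circ> transpose i (Suc i)) \<asymp> g_word x * g i" using *(2) by simp
    also have "\<dots> \<asymp> h_perm w * g i" by (intro cong_mult_right cong_sym[OF *(1)])
    finally show ?thesis by (intro exI[of _ 0] exI[of _ 1]) simp
  next
    assume ?B
    then have *: "h_perm (w \<circ> transpose i (Suc i)) \<asymp> g_word x" "h_perm w \<asymp> g_word (x @ [i])"
      by (auto intro: h_perm_reduced simp del: g_word_simps)
    have "h_perm w * g i \<asymp> g_word x * (g i * g i)"
      using cong_mult_right[OF *(2), of "g i"] by (simp add: mult.assoc)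
    also have "\<dots> \<asymp> g_word x * (z *s g i + 1)"
      using hecke_quadratic[OF assms(2,3)] by (rule cong_mult_left)
    also have "\<dots> = z *s g_word (x @ [i]) + g_word x" by (simp add: distrib_left scale_mult_right)
    finally have "h_perm w * g i - z *s h_perm w \<asymp> z *s g_word (x @ [i]) + g_word x - z *s g_word (x @ [i])"
      by (intro cong_diff cong_scale *(2))
    then have "h_perm w * g i - z *s h_perm w \<asymp> h_perm (w \<circ> transpose i (Suc i))"
      using cong_sym[OF *(1)] by (auto intro: cong_trans)
    from cong_sym[OF this] show ?thesis
      by (intro exI[of _ "- z"] exI[of _ 1]) simp
  qed
qed

lemma h_perm_coset:
  assumes "w permutes {1..n}" "J \<subseteq> {1..<n}" "set x \<subseteq> J"
  shows "h_perm (w \<circ> perm_of x) \<in> cspan ({h_perm w} * monomials J)"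
  using assms(3)
proof (induction x rule: rev_induct)
  case Nil
  have "h_perm w * 1 \<in> {h_perm w} * monomials J" by (intro set_times_intro one_in_monomials) simp
  then show ?case by (simp add: cspan_base)
next
  case (snoc i x)
  let ?u = "w \<circ> perm_of x"
  have "perm_of x permutes {1..n}" using snoc assms(2) by (intro perm_of_permutes) auto
  then have u: "?u permutes {1..n}" using assms(1) by (rule permutes_compose)
  have "1 \<le> i" "i < n" using snoc assms(2) by auto
  from h_perm_step[OF u this] obtain c d where
    cd: "h_perm (?u \<circ> transpose i (Suc i)) \<asymp> c *s h_perm ?u + d *s (h_perm ?u * g i)" by blast
  have IH: "h_perm ?u \<in> cspan ({h_perm w} * monomials J)"
    using snoc.prems by (intro snoc.IH) auto
  have "h_perm ?u * g i \<in> cspan ({h_perm w} * monomials J)"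
  proof (rule cspan_right[OF IH])
    fix s assume "s \<in> {h_perm w} * monomials J"
    then obtain a where a: "s = h_perm w * a" "a \<in> monomials J" by (auto elim: set_times_elim)
    have "a * g i \<in> monomials J" using a snoc by (intro monomials_mult gen_in_monomials) auto
    then show "s * g i \<in> cspan ({h_perm w} * monomials J)"
      unfolding a(1) mult.assoc by (intro cspan_base set_times_intro) auto
  qed
  then have "c *s h_perm ?u + d *s (h_perm ?u * g i) \<in> cspan ({h_perm w} * monomials J)"
    by (intro cspan_add cspan_scale IH)
  with cd have "h_perm (?u \<circ> transpose i (Suc i)) \<in> cspan ({h_perm w} * monomials J)" by (rule cspan_cong_mem)
  then show ?case unfolding perm_of_append perm_of_Cons perm_of_Nil comp_id o_assoc .
qed

text \<open>
  By \<open>h_perm_coset\<close> each \<open>h\<^sub>w\<close> is reached from every member of the coset of \<open>w\<close>, in particular from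
  a shortest one.
\<close>

lemma cspan_monomials_coset:
  assumes "J \<subseteq> {1..<n}" "P = perm_of ` {x. set x \<subseteq> J}"
  shows "cspan (monomials {1..<n}) = cspan (h_perm ` shortest_reps n P * monomials J)"
proof -
  have reps: "w permutes {1..n}" if "w \<in> shortest_reps n P" for w
    using that by (simp add: shortest_reps_def)
  have "h_perm w \<in> cspan (h_perm ` shortest_reps n P * monomials J)" if w: "w permutes {1..n}" for w
  proof -
    have "perm_of [] \<in> P" unfolding assms(2) by (intro imageI) simp
    then obtain v where v: "v \<in> P" "\<And>u. u \<in> P \<Longrightarrow> len n (w \<circ> v) \<le> len n (w \<circ> u)"
      using ex_has_least_nat[of "\<lambda>v. v \<in> P" "perm_of []" "\<lambda>v. len n (w \<circ> v)"] by blast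
    obtain x where x: "v = perm_of x" "set x \<subseteq> J" using v(1) assms(2) by auto
    have "perm_of x permutes {1..n}" using x(2) assms(1) by (intro perm_of_permutes) auto
    then have wv: "w \<circ> v permutes {1..n}" unfolding x(1) using w by (rule permutes_compose)
    have "w \<circ> v \<in> shortest_reps n P"
      unfolding shortest_reps_def
    proof (intro CollectI conjI ballI wv)
      fix u assume "u \<in> P"
      then obtain y where y: "u = perm_of y" "set y \<subseteq> J" using assms(2) by auto
      have "v \<circ> u \<in> P" unfolding assms(2) using x y
        by (intro image_eqI[of _ _ "x @ y"]) (auto simp: perm_of_append)
      then show "len n (w \<circ> v) \<le> len n (w \<circ> v \<circ> u)" using v(2)[of "v \<circ> u"] unfolding o_assoc by blast
    qed
    then have "{h_perm (w \<circ> v)} * monomials J \<subseteq> h_perm ` shortest_reps n P * monomials J"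
      by (intro set_times_mono2) auto
    moreover have "w = w \<circ> v \<circ> perm_of (rev x)"
      using perm_of_rev_cancel[of "rev x"] x(1) by (simp add: o_assoc[symmetric])
    moreover have "h_perm (w \<circ> v \<circ> perm_of (rev x)) \<in> cspan ({h_perm (w \<circ> v)} * monomials J)"
      using x(2) by (intro h_perm_coset[OF wv assms(1)]) simp
    ultimately show ?thesis using cspan_mono by (metis subsetD)
  qed
  then have "cspan (h_perm ` {w. w permutes {1..n}}) \<subseteq> cspan (h_perm ` shortest_reps n P * monomials J)"
    by (intro cspan_subset) blast
  moreover have "h_perm ` shortest_reps n P * monomials J \<subseteq> monomials {1..<n}"
    using monomials_subset[OF assms(1)] h_perm_in_monomials[OF reps] monomials_mult
    by (blast elim!: set_times_elim)
  then have "cspan (h_perm ` shortest_reps n P * monomials J) \<subseteq> cspan (monomials {1..<n})"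
    by (rule cspan_mono)
  ultimately show ?thesis using cspan_monomials_eq_h_perm by simp
qed

lemma monomials_times:
  assumes "J \<subseteq> J'" shows "cspan (monomials J' * monomials J) = cspan (monomials J')"
proof -
  have "x * 1 \<in> monomials J' * monomials J" if "x \<in> monomials J'" for x
    using that one_in_monomials by (rule set_times_intro)
  then have "monomials J' \<subseteq> monomials J' * monomials J" by auto
  moreover have "monomials J' * monomials J \<subseteq> monomials J'"
    using monomials_subset[OF assms] by (auto elim!: set_times_elim intro!: monomials_mult)
  ultimately show ?thesis by (intro arg_cong[of _ _ cspan]) auto
qed

text \<open>
  The recursion for normal words expresses that $H_{m+1}$ is the sum of the
  $g_j\cdots g_mH_m$ with $1\le j\le m+1$; the product is empty for $j=m+1$.
\<close>

lemma cspan_monomials_Suc: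
  assumes "Suc m \<le> n"
  shows "cspan (monomials {1..<Suc m})
    = cspan ((\<Union>j\<in>{1..Suc m}. {g_word [j..<Suc m]}) * monomials {1..<m})"
proof -
  have "g_word ` normal_words (Suc m) = (\<Union>j\<in>{1..Suc m}. {g_word [j..<Suc m]}) * (g_word ` normal_words m)"
    (is "?A = ?B")
  proof
    show "?A \<subseteq> ?B"
    proof
      fix x assume "x \<in> ?A"
      then obtain j v where jv: "1 \<le> j" "j \<le> Suc m" "v \<in> normal_words m" "x = g_word [j..<Suc m] * g_word v"
        by (auto simp del: upt_Suc)
      show "x \<in> ?B"
        unfolding jv(4) using jv(1-3) by (intro set_times_intro UN_I[of j] imageI) auto
    qed
    show "?B \<subseteq> ?A"
      by (auto elim!: set_times_elim simp del: upt_Suc simp flip: g_word_simps(3)) blast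
  qed
  then show ?thesis
    using cspan_times_cong[OF refl cspan_monomials_eq_normal[of m]]
      cspan_monomials_eq_normal[OF assms] assms by simp
qed

lemma cspan_monomials_Suc_elim:
  assumes "Suc m \<le> n" "\<And>j a. 1 \<le> j \<Longrightarrow> j \<le> Suc m \<Longrightarrow> a \<in> monomials {1..<m} \<Longrightarrow>
      u * (g_word [j..<Suc m] * a) * v \<in> cspan T"
    and "x \<in> monomials {1..<Suc m}"
  shows "u * x * v \<in> cspan T"
proof (rule cspan_sandwich)
  show "x \<in> cspan ((\<Union>j\<in>{1..Suc m}. {g_word [j..<Suc m]}) * monomials {1..<m})"
    using cspan_monomials_Suc[OF assms(1)] assms(3) cspan_base by blast
qed (use assms(2) in \<open>auto elim!: set_times_elim simp del: upt_Suc\<close>)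

text \<open>
  The decomposition of $H_n$ for the subgroup that fixes \<open>1\<close>, with the coset representatives on
  the right. It isolates the part of $H_n$ that commutes with $e_{(1)}$. The right-hand side
  contains \<open>1\<close>, and it is closed under right multiplication by $g_i$: for \<open>i < k - 1\<close> and
  \<open>i > k\<close> the letter moves to the left through the chain $g_1\cdots g_{k-1}$.
\<close>

lemma cspan_monomials_tail:
  assumes "1 \<le> n"
  shows "cspan (monomials {1..<n}) = cspan (monomials {2..<n} * (\<Union>k\<in>{1..n}. {g_word [1..<k]}))"
  (is "_ = cspan ?T")
proof (rule cspan_eqI)
  show "?T \<subseteq> cspan (monomials {1..<n})"
    using monomials_subset[of "{2..<n}" "{1..<n}"]
    by (auto elim!: set_times_elim intro!: cspan_base monomials_mult g_word_in_monomials)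
  have T: "a * g_word [1..<k] \<in> ?T" if "a \<in> monomials {2..<n}" "1 \<le> k" "k \<le> n" for a k
    using that by (intro set_times_intro) auto
  have "g_word x \<in> cspan ?T" if "set x \<subseteq> {1..<n}" for x
    using that
  proof (induction x rule: rev_induct)
    case Nil
    show ?case using T[OF one_in_monomials, of 1] assms by (simp add: cspan_base)
  next
    case (snoc i x)
    have i: "1 \<le> i" "i < n" using snoc.prems by auto
    have "s * g i \<in> cspan ?T" if s: "s \<in> ?T" for s
    proof -
      from s obtain a k where ak: "s = a * g_word [1..<k]" "a \<in> monomials {2..<n}" "1 \<le> k" "k \<le> n"
        by (auto elim!: set_times_elim)
      have shift: ?thesis if "g_word [1..<k] * g i \<asymp> g l * g_word [1..<k]" "2 \<le> l" "l < n" for l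
      proof -
        have "s * g i \<asymp> (a * g l) * g_word [1..<k]"
          unfolding ak(1) using cong_mult_left[OF that(1), of a] by (simp add: mult.assoc)
        moreover have "(a * g l) * g_word [1..<k] \<in> cspan ?T"
          using that ak by (intro cspan_base T monomials_mult gen_in_monomials) auto
        ultimately show ?thesis by (rule cspan_cong_mem)
      qed
      consider "i < k - 1" | "i = k - 1" | "i = k" | "k < i" by linarith
      then show ?thesis
      proof cases
        case 1
        have "Suc i # [1..<Suc (k - 1)] \<sim> [1..<Suc (k - 1)] @ [i]"
          using chain_shift[of 1 "Suc i" "k - 1"] 1 i by simp
        then have "g_word (Suc i # [1..<k]) \<asymp> g_word ([1..<k] @ [i])"
          using ak 1 i by (intro g_word_braid_equiv) auto
        then show ?thesis using 1 ak i by (intro shift[of "Suc i"]) (auto intro: cong_sym)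
      next
        case 2
        then have "k = Suc i" using i by simp
        then have k: "[1..<k] = [1..<i] @ [i]" using i by simp
        have "s * g i = (a * g_word [1..<i]) * (g i * g i)"
          unfolding ak(1) k by (simp add: mult.assoc)
        also have "\<dots> \<asymp> (a * g_word [1..<i]) * (z *s g i + 1)"
          using hecke_quadratic[OF i] by (rule cong_mult_left)
        also have "\<dots> = z *s s + a * g_word [1..<i]"
          unfolding ak(1) k by (simp add: distrib_left scale_mult_right mult.assoc)
        finally show ?thesis
        proof (rule cspan_cong_mem)
          show "z *s s + a * g_word [1..<i] \<in> cspan ?T"
            using s T ak i by (intro cspan_add cspan_scale cspan_base) auto
        qed
      next
        case 3
        then have "s * g i = a * g_word [1..<Suc k]" using ak by (simp add: mult.assoc)
        then show ?thesis using T ak 3 i by (auto intro: cspan_base simp del: upt_Suc)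
      next
        case 4
        have "g i * g_word [1..<k] \<asymp> g_word [1..<k] * g i"
          using 4 i ak
          by (intro gen_commute_monomials[of _ "{1..<k}"] g_word_in_monomials) auto
        then show ?thesis using 4 ak i by (intro shift[of i]) (auto intro: cong_sym)
      qed
    qed
    then show ?case using cspan_right[of "g_word x" ?T "g i" ?T] snoc by simp
  qed
  then show "monomials {1..<n} \<subseteq> cspan ?T" by (auto simp: monomials_def)
qed

end

section \<open>The modules generated by the idempotents\<close>

text \<open>
  The words that stand for the elements of $\mathcal{B}_r$. There are as many of them as there are
  involutions in $S_r$.
\<close>

fun involution_words :: "nat \<Rightarrow> nat list set" where
  "involution_words 0 = {[]}"
| "involution_words (Suc 0) = {[]}"
| "involution_words (Suc (Suc r)) =
     involution_words (Suc r) \<union> (\<Union>j\<in>{1..r+1}. (\<lambda>v. [j..<r+2] @ v) ` involution_words r)"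

lemma involution_words_letters: "x \<in> involution_words r \<Longrightarrow> set x \<subseteq> {1..<r}"
  by (induction r arbitrary: x rule: involution_words.induct) (fastforce simp del: upt_Suc)+

text \<open>
  The relations of $C_n$ in terms of the $g_i$ instead of the $u_i=q-g_i$. Then the two signs
  differ only in $\epsilon=\pm1$ and in $\gamma$, which is \<open>q\<close> minus the coefficient in the recursion
  for $e_{(r)}$. The map \<open>\<tau>\<close> is the reversal of words; because it preserves \<open>K\<close>, the relations
  with all products reversed hold as well.
\<close>

locale C_mod_ideal = hecke_mod_ideal scale K n z g
  for scale :: "'k::field \<Rightarrow> 'a::ring_1 \<Rightarrow> 'a" (infixr "*s" 75) and K n z g +
  fixes \<epsilon> \<gamma> :: 'k and e :: "nat \<Rightarrow> 'a" and \<tau> :: "'a \<Rightarrow> 'a"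
  assumes sign_square: "\<epsilon> * \<epsilon> = 1"
    and e_0: "e 0 = 1"
    and e_idem: "1 \<le> r \<Longrightarrow> r \<le> n \<Longrightarrow> e r * e r \<asymp> e r"
    and e_Suc: "1 \<le> r \<Longrightarrow> r < n \<Longrightarrow> e (Suc r) \<asymp> \<epsilon> *s (\<gamma> *s e r - e r * g r * e r)"
    and e_far: "1 \<le> r \<Longrightarrow> r < j \<Longrightarrow> j < n \<Longrightarrow> e r * g j \<asymp> g j * e r"
    and e_braid: "1 \<le> i \<Longrightarrow> Suc i < r \<Longrightarrow> r \<le> n \<Longrightarrow>
      g (Suc i) * g i * e r \<asymp> (g i * g (Suc i) + \<epsilon> *s (g i - g (Suc i))) * e r"
    and rev_add: "\<tau> (x + y) = \<tau> x + \<tau> y"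
    and rev_scale: "\<tau> (c *s x) = c *s \<tau> x"
    and rev_mult: "\<tau> (x * y) = \<tau> y * \<tau> x"
    and rev_one: "\<tau> 1 = 1"
    and rev_g: "\<tau> (g i) = g i"
    and rev_e: "\<tau> (e r) = e r"
    and rev_ideal: "x \<in> K \<Longrightarrow> \<tau> x \<in> K"
begin

lemma rev_g_word: "\<tau> (g_word x) = g_word (rev x)"
  by (induction x) (auto simp: rev_one rev_mult rev_g)

lemma rev_monomials: "\<tau> ` monomials J = monomials J"
proof -
  have "\<tau> ` monomials J = g_word ` rev ` {x. set x \<subseteq> J}" by (simp add: monomials_def image_image rev_g_word)
  also have "rev ` {x. set x \<subseteq> J} = {x. set x \<subseteq> J}" by (force intro: image_eqI[of _ rev "rev _"])
  finally show ?thesis by (simp add: monomials_def)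
qed

lemma rev_times: "\<tau> ` (S * T) = \<tau> ` T * \<tau> ` S"
  by (auto simp: set_times_image rev_mult image_iff) (metis rev_mult)+

lemma rev_cspan: "x \<in> cspan S \<Longrightarrow> \<tau> x \<in> cspan (\<tau> ` S)"
proof -
  have "\<tau> 0 = 0" using rev_add[of 0 0] by simp
  then have "subspace {x. \<tau> x \<in> cspan (\<tau> ` S)}"
    by (intro subspaceI) (auto simp: rev_add rev_scale intro: cspan_zero cspan_add cspan_scale)
  moreover have "S \<union> K \<subseteq> {x. \<tau> x \<in> cspan (\<tau> ` S)}"
    by (auto intro: cspan_base ideal_in_cspan rev_ideal)
  ultimately show "x \<in> cspan S \<Longrightarrow> \<tau> x \<in> cspan (\<tau> ` S)"
    using span_minimal unfolding cspan_def by blast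
qed

lemma rev_cspan_eq: "cspan S = cspan T \<Longrightarrow> cspan (\<tau> ` S) = cspan (\<tau> ` T)"
  by (intro cspan_eqI) (use rev_cspan cspan_base in blast)+

lemma e_far_monomials:
  assumes "a \<in> monomials J" "J \<subseteq> {Suc r..<n}"
  shows "e r * a \<asymp> a * e r"
proof -
  from assms(1) obtain x where x: "a = g_word x" "set x \<subseteq> J" by (auto simp: monomials_def)
  have "e r * g j \<asymp> g j * e r" if "j \<in> set x" for j
    using e_far[of r j] that x(2) assms(2) by (cases "r = 0") (auto simp: e_0)
  then show ?thesis unfolding x by (rule cong_commute_g_word)
qed

text \<open>
  The recursion writes $e_{(s+1)}$ as $e_{(s)}$ times something.
\<close>

lemma e_absorb:
  assumes "r \<le> s" "s \<le> n"
  shows "e r * e s \<asymp> e s"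
  using assms
proof (induction "s - r" arbitrary: s)
  case 0
  then show ?case using e_idem[of r] by (cases "r = 0") (auto simp: e_0)
next
  case (Suc d)
  show ?case
  proof (cases "r = 0")
    case False
    obtain t where t: "s = Suc t" using Suc by (cases s) auto
    have IH: "e r * e t \<asymp> e t" using Suc t by auto
    have Ht: "e s \<asymp> \<epsilon> *s (\<gamma> *s e t - e t * g t * e t)" using e_Suc Suc False t by auto
    then have "e r * e s \<asymp> e r * (\<epsilon> *s (\<gamma> *s e t - e t * g t * e t))" by (rule cong_mult_left)
    also have "\<dots> = \<epsilon> *s (\<gamma> *s (e r * e t) - e r * e t * g t * e t)"
      by (simp add: scale_mult_right right_diff_distrib mult.assoc)
    also have "\<dots> \<asymp> \<epsilon> *s (\<gamma> *s e t - e t * g t * e t)"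
      by (intro cong_scale cong_diff cong_mult_right IH)
    also have "\<dots> \<asymp> e s" by (rule cong_sym[OF Ht])
    finally show ?thesis .
  qed (simp add: e_0)
qed

lemma e_g_e:
  assumes "1 \<le> r" "r < n"
  shows "e r * g r * e r \<asymp> \<gamma> *s e r - \<epsilon> *s e (Suc r)"
proof -
  have "\<epsilon> *s e (Suc r) \<asymp> \<epsilon> *s (\<epsilon> *s (\<gamma> *s e r - e r * g r * e r))"
    by (intro cong_scale e_Suc assms)
  then have "\<epsilon> *s e (Suc r) \<asymp> \<gamma> *s e r - e r * g r * e r" by (simp add: sign_square)
  from cong_diff[OF cong_refl this, of "\<gamma> *s e r"] show ?thesis by (simp add: cong_sym)
qed

text \<open>
  By \<open>cspan_monomials_Suc\<close> $H_{m+2}$ is $H_{m+1}+H_{m+1}g_{m+1}H_{m+1}$, so that it must be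
  shown that $g_{m+1}H_{m+1}e$ lies in $H_{m+1}e+H_{m+1}g_{m+1}H_me$. By induction
  $H_{m+1}e=H_me+H_mg_mH_{m-1}e$. Here $g_{m+1}H_me$ has the right form, and
  $g_{m+1}H_mg_mH_{m-1}e=H_mH_{m-1}\,g_{m+1}g_me$, because $H_m$ commutes with $g_{m+1}$ and
  $H_{m-1}$ with both factors. Finally $g_{m+1}g_me$ is a combination of $g_mg_{m+1}e$, $g_me$ and
  $g_{m+1}e$.
\<close>

lemma cspan_monomials_e_step:
  assumes "Suc (Suc m) \<le> s" "s \<le> n"
  shows "cspan (monomials {1..<Suc (Suc m)} * {e s}) =
    cspan (monomials {1..<Suc m} * {e s}
      \<union> monomials {1..<Suc m} * {g (Suc m)} * monomials {1..<m} * {e s})"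
    (is "_ = cspan (?V m)")
  using assms(1)
proof (induction m rule: less_induct)
  case (less m)
  let ?M = "\<lambda>k. monomials {1..<k}"
  have sub: "?M k \<subseteq> ?M l" if "k \<le> l" for k l using that by (intro monomials_subset) auto
  have V1: "a * e s \<in> cspan (?V m)" if "a \<in> ?M (Suc m)" for a
    using that by (intro cspan_base UnI1 set_times_intro) auto
  have V2: "a * (g (Suc m) * (b * e s)) \<in> cspan (?V m)" if "a \<in> ?M (Suc m)" "b \<in> ?M m" for a b
  proof -
    have "a * g (Suc m) * b * e s \<in> ?M (Suc m) * {g (Suc m)} * ?M m * {e s}"
      using that by (intro set_times_intro) auto
    then show ?thesis by (intro cspan_base) (simp add: mult.assoc)
  qed
  have stable: "a * x \<in> cspan (?V m)" if "a \<in> ?M (Suc m)" "x \<in> cspan (?V m)" for a x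
  proof (rule cspan_left[OF that(2)])
    fix y assume "y \<in> ?V m"
    then consider b where "b \<in> ?M (Suc m)" "y = b * e s"
      | b c where "b \<in> ?M (Suc m)" "c \<in> ?M m" "y = b * g (Suc m) * c * e s"
      by (auto elim!: set_times_elim)
    then show "a * y \<in> cspan (?V m)"
    proof cases
      case 1
      then show ?thesis using V1[of "a * b"] monomials_mult[OF that(1)] by (simp add: mult.assoc)
    next
      case 2
      then show ?thesis using V2[of "a * b" c] monomials_mult[OF that(1)] by (simp add: mult.assoc)
    qed
  qed
  have key: "g (Suc m) * a * e s \<in> cspan (?V m)" if a: "a \<in> ?M (Suc m)" for a
  proof (cases m)
    case 0
    then have "a = 1" using a by (simp add: monomials_empty)
    then show ?thesis using V2[of 1 1] one_in_monomials by simp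
  next
    case (Suc k)
    have "a * e s \<in> cspan (?V k)"
      using less.IH[of k] less.prems Suc a by (auto intro: cspan_base set_times_intro)
    then have "g (Suc m) * (a * e s) \<in> cspan (?V m)"
    proof (rule cspan_left)
      fix y assume "y \<in> ?V k"
      then consider b where "b \<in> ?M m" "y = b * e s"
        | b c where "b \<in> ?M m" "c \<in> ?M k" "y = b * g m * c * e s"
        using Suc by (auto elim!: set_times_elim)
      then show "g (Suc m) * y \<in> cspan (?V m)"
      proof cases
        case 1
        then show ?thesis using V2[of 1 b] one_in_monomials by simp
      next
        case 2
        \<comment> \<open>move $g_{m+1}$ to the right and $g_m$ next to it\<close>
        have far: "g (Suc m) * b \<asymp> b * g (Suc m)"
          using less.prems assms(2) by (intro gen_commute_monomials[OF 2(1)]) auto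
        have far': "g (Suc m) * c \<asymp> c * g (Suc m)" "g m * c \<asymp> c * g m"
          using less.prems assms(2) Suc by (intro gen_commute_monomials[OF 2(2)]; force)+
        have "c * (g (Suc m) * g m) \<asymp> g (Suc m) * c * g m"
          using cong_mult_right[OF cong_sym[OF far'(1)], of "g m"] by (simp add: mult.assoc)
        also have "\<dots> \<asymp> g (Suc m) * (g m * c)"
          using cong_mult_left[OF cong_sym[OF far'(2)], of "g (Suc m)"] by (simp add: mult.assoc)
        finally have c: "g (Suc m) * (g m * c) \<asymp> c * (g (Suc m) * g m)" by (rule cong_sym)
        have "g (Suc m) * y \<asymp> b * g (Suc m) * (g m * c * e s)"
          using cong_mult_right[OF far, of "g m * c * e s"] 2(3) by (simp add: mult.assoc)
        also have "\<dots> = b * (g (Suc m) * (g m * c)) * e s" by (simp add: mult.assoc)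
        also have "\<dots> \<asymp> b * (c * (g (Suc m) * g m)) * e s"
          by (intro cong_mult_right cong_mult_left c)
        also have "\<dots> = b * c * (g (Suc m) * g m * e s)" by (simp add: mult.assoc)
        also have "\<dots> \<asymp> b * c * ((g m * g (Suc m) + \<epsilon> *s (g m - g (Suc m))) * e s)"
          using less.prems assms(2) Suc by (intro cong_mult_left e_braid) auto
        finally have *: "g (Suc m) * y \<asymp> b * c * ((g m * g (Suc m) + \<epsilon> *s (g m - g (Suc m))) * e s)" .
        have gm: "g m \<in> ?M (Suc m)" using Suc by (intro gen_in_monomials) auto
        have bc: "b * c \<in> ?M (Suc m)"
          using 2 sub[of m "Suc m"] sub[of k "Suc m"] Suc by (intro monomials_mult) auto
        have "g m * (g (Suc m) * (1 * e s)) + \<epsilon> *s (g m * e s - 1 * (g (Suc m) * (1 * e s)))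
            \<in> cspan (?V m)"
          by (intro cspan_add cspan_scale cspan_diff V1 V2 gm one_in_monomials)
        then have "(g m * g (Suc m) + \<epsilon> *s (g m - g (Suc m))) * e s \<in> cspan (?V m)"
          by (simp add: distrib_right left_diff_distrib scale_mult_left mult.assoc)
        from cspan_cong_mem[OF * stable[OF bc this]] show ?thesis .
      qed
    qed
    then show ?thesis by (simp add: mult.assoc)
  qed
  show ?case
  proof (rule cspan_eqI)
    show "?M (Suc (Suc m)) * {e s} \<subseteq> cspan (?V m)"
    proof
      fix y assume "y \<in> ?M (Suc (Suc m)) * {e s}"
      then obtain x where x: "x \<in> ?M (Suc (Suc m))" "y = x * e s" by (auto elim: set_times_elim)
      have "1 * x * e s \<in> cspan (?V m)"
      proof (rule cspan_monomials_Suc_elim[OF _ _ x(1)])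
        fix j a assume j: "1 \<le> j" "j \<le> Suc (Suc m)" and a: "a \<in> ?M (Suc m)"
        show "1 * (g_word [j..<Suc (Suc m)] * a) * e s \<in> cspan (?V m)"
        proof (cases "j = Suc (Suc m)")
          case True
          then show ?thesis using V1[OF a] by simp
        next
          case False
          then have "[j..<Suc (Suc m)] = [j..<Suc m] @ [Suc m]" using j by simp
          then have "g_word [j..<Suc (Suc m)] * a * e s = g_word [j..<Suc m] * (g (Suc m) * a * e s)"
            by (simp add: mult.assoc del: upt_Suc)
          moreover have "g_word [j..<Suc m] \<in> ?M (Suc m)" using j by (intro g_word_in_monomials) auto
          ultimately show ?thesis using stable key[OF a] by simp
        qed
      qed (use less.prems assms(2) in auto)
      then show "y \<in> cspan (?V m)" using x(2) by simp
    qed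
    show "?V m \<subseteq> cspan (?M (Suc (Suc m)) * {e s})"
    proof
      fix y assume "y \<in> ?V m"
      then consider b where "b \<in> ?M (Suc m)" "y = b * e s"
        | b c where "b \<in> ?M (Suc m)" "c \<in> ?M m" "y = b * g (Suc m) * c * e s"
        by (auto elim!: set_times_elim)
      then have "\<exists>x\<in>?M (Suc (Suc m)). y = x * e s"
      proof cases
        case 1
        then show ?thesis using sub[of "Suc m" "Suc (Suc m)"] by auto
      next
        case 2
        then have "b * g (Suc m) * c \<in> ?M (Suc (Suc m))"
          using sub[of "Suc m" "Suc (Suc m)"] sub[of m "Suc (Suc m)"]
          by (intro monomials_mult gen_in_monomials) auto
        then show ?thesis using 2(3) by blast
      qed
      then show "y \<in> cspan (?M (Suc (Suc m)) * {e s})"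
        by (auto intro!: cspan_base set_times_intro)
    qed
  qed
qed

text \<open>
  In the step, $H_{m+1}g_{m+1}H_me$ is the sum of the
  $g_j\cdots g_m\,H_m\,g_{m+1}H_me=g_j\cdots g_{m+1}\,H_me$ with $1\le j\le m+1$, which is the second
  part of the recursion for the words.
\<close>

lemma cspan_monomials_e:
  assumes "m \<le> s" "s \<le> n"
  shows "cspan (monomials {1..<m} * {e s}) = cspan (g_word ` involution_words m * {e s})"
  using assms(1)
proof (induction m rule: involution_words.induct)
  case (3 m)
  let ?M = "\<lambda>k. monomials {1..<k}"
  let ?B = "\<lambda>k. g_word ` involution_words k"
  have IH1: "cspan (?M (Suc m) * {e s}) = cspan (?B (Suc m) * {e s})"
    and IH2: "cspan (?M m * {e s}) = cspan (?B m * {e s})"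
    using 3 by auto
  have sub: "?B (Suc m) * {e s} \<subseteq> ?B (Suc (Suc m)) * {e s}"
    by (intro set_times_mono2) auto
  show ?case
  proof (rule cspan_eqI)
    have "?M (Suc m) * {e s} \<union> ?M (Suc m) * {g (Suc m)} * ?M m * {e s}
      \<subseteq> cspan (?B (Suc (Suc m)) * {e s})"
    proof (rule Un_least)
      show "?M (Suc m) * {e s} \<subseteq> cspan (?B (Suc (Suc m)) * {e s})"
        using IH1 cspan_mono[OF sub] cspan_base by blast
      show "?M (Suc m) * {g (Suc m)} * ?M m * {e s} \<subseteq> cspan (?B (Suc (Suc m)) * {e s})"
      proof
        fix y assume "y \<in> ?M (Suc m) * {g (Suc m)} * ?M m * {e s}"
        then obtain b c where y: "b \<in> ?M (Suc m)" "c \<in> ?M m" "y = b * g (Suc m) * c * e s"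
          by (auto elim!: set_times_elim)
        have "1 * b * (g (Suc m) * c * e s) \<in> cspan (?B (Suc (Suc m)) * {e s})"
        proof (rule cspan_monomials_Suc_elim[OF _ _ y(1)])
          fix j a assume j: "1 \<le> j" "j \<le> Suc m" and a: "a \<in> ?M m"
          have far: "g (Suc m) * a \<asymp> a * g (Suc m)"
            using "3.prems" assms(2) by (intro gen_commute_monomials[OF a]) auto
          have chain: "[j..<Suc (Suc m)] = [j..<Suc m] @ [Suc m]" using j by simp
          have "1 * (g_word [j..<Suc m] * a) * (g (Suc m) * c * e s)
              = g_word [j..<Suc m] * (a * g (Suc m)) * (c * e s)"
            by (simp add: mult.assoc)
          also have "\<dots> \<asymp> g_word [j..<Suc m] * (g (Suc m) * a) * (c * e s)"
            by (intro cong_mult_right cong_mult_left cong_sym[OF far])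
          also have "\<dots> = g_word [j..<Suc (Suc m)] * (a * c * e s)"
            unfolding chain by (simp add: mult.assoc)
          finally have *: "1 * (g_word [j..<Suc m] * a) * (g (Suc m) * c * e s)
            \<asymp> g_word [j..<Suc (Suc m)] * (a * c * e s)" .
          have "a * c * e s \<in> ?M m * {e s}" using a y by (intro set_times_intro monomials_mult) auto
          then have "a * c * e s \<in> cspan (?B m * {e s})" using IH2 cspan_base by blast
          then have "g_word [j..<Suc (Suc m)] * (a * c * e s) \<in> cspan (?B (Suc (Suc m)) * {e s})"
          proof (rule cspan_left)
            fix u assume "u \<in> ?B m * {e s}"
            then obtain v where v: "v \<in> involution_words m" "u = g_word v * e s"
              by (auto elim!: set_times_elim)
            have "[j..<Suc (Suc m)] @ v \<in> involution_words (Suc (Suc m))"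
              using v(1) j by (auto simp del: upt_Suc intro!: bexI[of _ j])
            then have "g_word ([j..<Suc (Suc m)] @ v) * e s \<in> ?B (Suc (Suc m)) * {e s}"
              by (intro set_times_intro imageI) auto
            then show "g_word [j..<Suc (Suc m)] * u \<in> cspan (?B (Suc (Suc m)) * {e s})"
              unfolding v(2) by (intro cspan_base) (simp add: mult.assoc del: upt_Suc)
          qed
          with * show "1 * (g_word [j..<Suc m] * a) * (g (Suc m) * c * e s)
            \<in> cspan (?B (Suc (Suc m)) * {e s})" by (rule cspan_cong_mem)
        qed (use "3.prems" assms(2) in auto)
        then show "y \<in> cspan (?B (Suc (Suc m)) * {e s})" unfolding y(3) by (simp add: mult.assoc)
      qed
    qed
    then have "cspan (?M (Suc m) * {e s} \<union> ?M (Suc m) * {g (Suc m)} * ?M m * {e s})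
      \<subseteq> cspan (?B (Suc (Suc m)) * {e s})" by (rule cspan_subset)
    then show "?M (Suc (Suc m)) * {e s} \<subseteq> cspan (?B (Suc (Suc m)) * {e s})"
      using cspan_monomials_e_step[OF "3.prems" assms(2)] cspan_base by blast
    have "?B (Suc (Suc m)) \<subseteq> ?M (Suc (Suc m))"
      using involution_words_letters g_word_in_monomials by blast
    then have "?B (Suc (Suc m)) * {e s} \<subseteq> ?M (Suc (Suc m)) * {e s}"
      by (rule set_times_mono2) (rule order_refl)
    then show "?B (Suc (Suc m)) * {e s} \<subseteq> cspan (?M (Suc (Suc m)) * {e s})"
      using cspan_base by blast
  qed
qed (simp_all add: monomials_empty)

definition C_reps :: "nat \<Rightarrow> 'a set"
  where "C_reps r = h_perm ` shortest_reps n {v. v permutes {1..r}}"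

definition D_reps :: "nat \<Rightarrow> 'a set"
  where "D_reps r = h_perm ` shortest_reps n {v \<circ> v' | v v'. v permutes {1..r} \<and> v' permutes {r+1..n}}"

text \<open>
  The reversal of $H_n=\mathcal{D}_{n,r}H_rH'$, where $H'$ is generated by $g_{r+1},\dots,g_{n-1}$.
\<close>

lemma cspan_monomials_D:
  assumes "r \<le> n"
  shows "cspan (monomials {1..<n}) =
    cspan (monomials {r+1..<n} * (monomials {1..<r} * \<tau> ` D_reps r))"
proof -
  let ?J = "{1..<r} \<union> {r+1..<n}"
  have "cspan (monomials ?J) = cspan (monomials {1..<r} * monomials {r+1..<n})"
  proof (rule cspan_eq_of_cong)
    fix x assume "x \<in> monomials ?J"
    then obtain u where u: "set u \<subseteq> ?J" "x = g_word u" by (auto simp: monomials_def)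
    obtain a b where ab: "set a \<subseteq> {1..<r}" "set b \<subseteq> {r+1..<n}" "u \<sim> a @ b"
      using split_far_letters[OF u(1)] by blast
    have "g_word u \<asymp> g_word (a @ b)" using ab(3) u(1) assms by (intro g_word_braid_equiv) auto
    then have "x \<asymp> g_word a * g_word b" using u(2) by simp
    moreover have "g_word a * g_word b \<in> monomials {1..<r} * monomials {r+1..<n}"
      using ab by (intro set_times_intro g_word_in_monomials)
    ultimately show "\<exists>y\<in>monomials {1..<r} * monomials {r+1..<n}. x \<asymp> y" by blast
  next
    fix y assume "y \<in> monomials {1..<r} * monomials {r+1..<n}"
    then obtain a b where y: "a \<in> monomials {1..<r}" "b \<in> monomials {r+1..<n}" "y = a * b"
      by (auto elim: set_times_elim)
    have "a \<in> monomials ?J" "b \<in> monomials ?J"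
      using y monomials_subset[of "{1..<r}" ?J] monomials_subset[of "{r+1..<n}" ?J] by auto
    then have "y \<in> monomials ?J" unfolding y(3) by (rule monomials_mult)
    then show "\<exists>x\<in>monomials ?J. y \<asymp> x" by (intro bexI[of _ y]) simp
  qed
  moreover have "?J \<subseteq> {1..<n}" using assms by auto
  from cspan_monomials_coset[OF this parabolic_eq_perm_of]
  have "cspan (monomials {1..<n}) = cspan (D_reps r * monomials ?J)" by (simp add: D_reps_def)
  ultimately have "cspan (monomials {1..<n})
      = cspan (D_reps r * (monomials {1..<r} * monomials {r+1..<n}))"
    using cspan_times_cong[OF refl] by metis
  from rev_cspan_eq[OF this] show ?thesis by (simp add: rev_times rev_monomials mult.assoc)
qed

text \<open>
  The factor generated by $g_{r+1},\dots,g_{n-1}$ passes through \<open>e r\<close> into the left factor $H_n$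
  and is absorbed there. Only then is that left factor decomposed.
\<close>

theorem cspan_HeH:
  assumes "r \<le> n"
  shows "cspan (monomials {1..<n} * {e r} * monomials {1..<n}) =
    cspan (C_reps r * (g_word ` involution_words r) * {e r}
      * (\<tau> ` g_word ` involution_words r) * (\<tau> ` D_reps r))"
proof -
  let ?M = "monomials {1..<n}" and ?R = "monomials {1..<r}" and ?F = "monomials {r+1..<n}"
    and ?B = "g_word ` involution_words r" and ?D = "\<tau> ` D_reps r"
  have Be: "cspan (?R * {e r}) = cspan (?B * {e r})" using assms by (intro cspan_monomials_e) auto
  have eB: "cspan ({e r} * ?R) = cspan ({e r} * \<tau> ` ?B)"
    using rev_cspan_eq[OF Be] by (simp add: rev_times rev_monomials rev_e)
  have eF: "cspan ({e r} * ?F) = cspan (?F * {e r})"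
    by (intro cspan_commute) (auto intro: e_far_monomials)
  have MF: "cspan (?M * ?F) = cspan ?M" by (intro monomials_times) auto
  have MR: "cspan ?M = cspan (C_reps r * ?R)"
    unfolding C_reps_def using assms perms_eq_perm_of[of 1 r]
    by (intro cspan_monomials_coset) auto
  note tc = cspan_times_cong
  have "cspan (?M * {e r} * ?M) = cspan (?M * {e r} * (?F * (?R * ?D)))"
    by (intro tc refl cspan_monomials_D assms)
  also have "\<dots> = cspan (?M * ({e r} * ?F) * (?R * ?D))" by (simp add: mult.assoc)
  also have "\<dots> = cspan (?M * (?F * {e r}) * (?R * ?D))" by (intro tc refl eF)
  also have "\<dots> = cspan ((?M * ?F) * ({e r} * (?R * ?D)))" by (simp add: mult.assoc)
  also have "\<dots> = cspan (?M * ({e r} * (?R * ?D)))" by (intro tc refl MF)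
  also have "\<dots> = cspan (?M * (({e r} * ?R) * ?D))" by (simp add: mult.assoc)
  also have "\<dots> = cspan (?M * (({e r} * \<tau> ` ?B) * ?D))" by (intro tc refl eB)
  also have "\<dots> = cspan ((C_reps r * ?R) * (({e r} * \<tau> ` ?B) * ?D))" by (intro tc refl MR)
  also have "\<dots> = cspan (C_reps r * (?R * {e r}) * (\<tau> ` ?B * ?D))" by (simp add: mult.assoc)
  also have "\<dots> = cspan (C_reps r * (?B * {e r}) * (\<tau> ` ?B * ?D))" by (intro tc refl Be)
  finally show ?thesis by (simp add: mult.assoc)
qed

subsection \<open>The sum of the two-sided ideals\<close>

definition ideal_sum :: "'a set" where
  "ideal_sum = cspan (\<Union>r\<in>{0..n}. monomials {1..<n} * {e r} * monomials {1..<n})"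

lemma ideal_sum_base:
  assumes "r \<le> n" "a \<in> monomials {1..<n}" "b \<in> monomials {1..<n}"
  shows "a * e r * b \<in> ideal_sum"
  unfolding ideal_sum_def using assms by (intro cspan_base UN_I[of r] set_times_intro) auto

lemma e_in_ideal_sum: "r \<le> n \<Longrightarrow> e r \<in> ideal_sum"
  using ideal_sum_base[of r 1 1] one_in_monomials by simp

lemma ideal_sum_left:
  assumes "\<And>r a b. r \<le> n \<Longrightarrow> a \<in> monomials {1..<n} \<Longrightarrow> b \<in> monomials {1..<n} \<Longrightarrow>
      c * (a * e r * b) \<in> ideal_sum"
    and "x \<in> ideal_sum"
  shows "c * x \<in> ideal_sum"
  using assms(2) unfolding ideal_sum_def
  by (rule cspan_left) (use assms(1) in \<open>auto simp: ideal_sum_def elim!: set_times_elim\<close>)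

lemma ideal_sum_mult_left:
  assumes "c \<in> monomials {1..<n}" "x \<in> ideal_sum"
  shows "c * x \<in> ideal_sum"
proof (rule ideal_sum_left[OF _ assms(2)])
  fix r a b assume "r \<le> n" "a \<in> monomials {1..<n}" "b \<in> monomials {1..<n}"
  then have "(c * a) * e r * b \<in> ideal_sum"
    using assms(1) by (intro ideal_sum_base monomials_mult)
  then show "c * (a * e r * b) \<in> ideal_sum" by (simp add: mult.assoc)
qed

lemma ideal_sum_mult_right:
  assumes "x \<in> ideal_sum" "c \<in> monomials {1..<n}"
  shows "x * c \<in> ideal_sum"
  using assms(1) unfolding ideal_sum_def
proof (rule cspan_right)
  fix y assume "y \<in> (\<Union>r\<in>{0..n}. monomials {1..<n} * {e r} * monomials {1..<n})"
  then obtain r a b where y: "r \<le> n" "a \<in> monomials {1..<n}" "b \<in> monomials {1..<n}" "y = a * e r * b"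
    by (auto elim!: set_times_elim)
  then have "a * e r * (b * c) \<in> ideal_sum"
    using assms(2) by (intro ideal_sum_base monomials_mult)
  then show "y * c \<in> cspan (\<Union>r\<in>{0..n}. monomials {1..<n} * {e r} * monomials {1..<n})"
    unfolding y(4) ideal_sum_def by (simp add: mult.assoc)
qed

lemma cspan_monomials_e_in_ideal_sum:
  assumes "r \<le> n" shows "cspan (monomials {1..<n} * {e r}) \<subseteq> ideal_sum"
  unfolding ideal_sum_def
proof (rule cspan_mono)
  have "x * 1 \<in> monomials {1..<n} * {e r} * monomials {1..<n}" if "x \<in> monomials {1..<n} * {e r}" for x
    using that one_in_monomials by (rule set_times_intro)
  then show "monomials {1..<n} * {e r} \<subseteq> (\<Union>r\<in>{0..n}. monomials {1..<n} * {e r} * monomials {1..<n})"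
    using assms by auto
qed

text \<open>
  The relation for $g_{k-1}g_ke_{(r)}$ moves $g_k$ in front of $g_{k-1}$. There it commutes with
  $g_1,\dots,g_{k-2}$ and with \<open>e\<close>, so that shorter chains remain. The shortest nontrivial chain
  is reduced by $e\,g_1\,e_{(r)}=(e\,g_1\,e)\,e_{(r)}=\gamma\,ee_{(r)}-\epsilon\,e_{(2)}e_{(r)}$.
\<close>

lemma e1_chain_e:
  assumes "k < r" "r \<le> n"
  shows "e 1 * g_word [1..<Suc k] * e r \<in> cspan (monomials {1..<n} * {e r})"
  using assms(1)
proof (induction k rule: less_induct)
  case (less k)
  let ?L = "cspan (monomials {1..<n} * {e r})"
  have stable: "c * x \<in> ?L" if "c \<in> monomials {1..<n}" "x \<in> ?L" for c x
  proof (rule cspan_left[OF that(2)])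
    fix y assume "y \<in> monomials {1..<n} * {e r}"
    then obtain a where "a \<in> monomials {1..<n}" "y = a * e r" by (auto elim: set_times_elim)
    moreover from this that(1) have "(c * a) * e r \<in> monomials {1..<n} * {e r}"
      by (intro set_times_intro monomials_mult) auto
    ultimately show "c * y \<in> ?L" by (auto simp: mult.assoc intro: cspan_base)
  qed
  have er: "e r \<in> ?L"
    using set_times_intro[OF one_in_monomials[of "{1..<n}"], of "e r" "{e r}"] by (simp add: cspan_base)
  have absorb: "e 1 * e r \<asymp> e r" using less.prems assms(2) by (intro e_absorb) auto
  consider "k = 0" | "k = 1" | l where "k = Suc (Suc l)"
    by (metis One_nat_def not0_implies_Suc)
  then show ?case
  proof cases
    case 1
    then show ?thesis using cspan_cong_mem[OF absorb er] by simp
  next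
    case 2
    have absorb2: "e 2 * e r \<asymp> e r" using less.prems 2 assms(2) by (intro e_absorb) auto
    have "e 1 * g 1 * e r \<asymp> e 1 * g 1 * (e 1 * e r)" by (intro cong_mult_left cong_sym[OF absorb])
    also have "\<dots> = e 1 * g 1 * e 1 * e r" by (simp add: mult.assoc)
    also have "\<dots> \<asymp> (\<gamma> *s e 1 - \<epsilon> *s e (Suc 1)) * e r"
      using less.prems 2 assms(2) by (intro cong_mult_right e_g_e) auto
    also have "\<dots> = \<gamma> *s (e 1 * e r) - \<epsilon> *s (e 2 * e r)"
      by (simp add: left_diff_distrib scale_mult_left numeral_2_eq_2)
    also have "\<dots> \<asymp> \<gamma> *s e r - \<epsilon> *s e r" by (intro cong_diff cong_scale absorb absorb2)
    finally have "e 1 * g 1 * e r \<in> ?L" by (rule cspan_cong_mem) (intro cspan_diff cspan_scale er)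
    then show ?thesis using 2 by simp
  next
    case (3 l)
    let ?i = "Suc l" and ?P = "g_word [1..<Suc l]"
    have IH: "e 1 * g_word [1..<Suc l] * e r \<in> ?L" "e 1 * g_word [1..<Suc (Suc l)] * e r \<in> ?L"
      using less.IH[of l] less.IH[of "Suc l"] less.prems 3 by auto
    have chain: "g_word [1..<Suc (Suc l)] = ?P * g ?i" "g_word [1..<Suc k] = ?P * g ?i * g (Suc ?i)"
      unfolding 3 by (simp_all add: mult.assoc)
    have far: "g (Suc ?i) * ?P \<asymp> ?P * g (Suc ?i)"
      using less.prems 3 assms(2)
      by (intro gen_commute_monomials[of _ "{1..<Suc l}"] g_word_in_monomials) auto
    have efar: "e 1 * g (Suc ?i) \<asymp> g (Suc ?i) * e 1"
      using less.prems 3 assms(2) by (intro e_far) auto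
    have move: "e 1 * ?P * g (Suc ?i) * x \<asymp> g (Suc ?i) * (e 1 * ?P * x)" for x
    proof -
      have "e 1 * ?P * g (Suc ?i) * x = e 1 * (?P * g (Suc ?i)) * x" by (simp add: mult.assoc)
      also have "\<dots> \<asymp> e 1 * (g (Suc ?i) * ?P) * x"
        by (intro cong_mult_left cong_mult_right cong_sym[OF far])
      also have "\<dots> = e 1 * g (Suc ?i) * (?P * x)" by (simp add: mult.assoc)
      also have "\<dots> \<asymp> g (Suc ?i) * e 1 * (?P * x)" by (intro cong_mult_right efar)
      finally show ?thesis by (simp add: mult.assoc)
    qed
    have "g (Suc ?i) * g ?i * e r \<asymp> (g ?i * g (Suc ?i) + \<epsilon> *s (g ?i - g (Suc ?i))) * e r"
      using less.prems 3 assms(2) by (intro e_braid) auto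
    from cong_diff[OF cong_sym[OF this] cong_refl[of "\<epsilon> *s (g ?i - g (Suc ?i)) * e r"]]
    have "g ?i * g (Suc ?i) * e r
        \<asymp> g (Suc ?i) * g ?i * e r - \<epsilon> *s (g ?i * e r - g (Suc ?i) * e r)"
      by (simp add: distrib_right left_diff_distrib scale_mult_left)
    from cong_mult_left[OF this, of "e 1 * ?P"]
    have "e 1 * g_word [1..<Suc k] * e r \<asymp> e 1 * ?P * g (Suc ?i) * (g ?i * e r)
        - \<epsilon> *s (e 1 * ?P * g ?i * e r - e 1 * ?P * g (Suc ?i) * e r)"
      unfolding chain by (simp add: mult.assoc right_diff_distrib scale_mult_right del: upt_Suc)
    also have "\<dots> \<asymp> g (Suc ?i) * (e 1 * ?P * (g ?i * e r))
        - \<epsilon> *s (e 1 * ?P * g ?i * e r - g (Suc ?i) * (e 1 * ?P * e r))"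
      by (intro cong_diff cong_scale move cong_refl)
    also have "\<dots> = g (Suc ?i) * (e 1 * g_word [1..<Suc (Suc l)] * e r)
        - \<epsilon> *s (e 1 * g_word [1..<Suc (Suc l)] * e r - g (Suc ?i) * (e 1 * ?P * e r))"
      unfolding chain by (simp add: mult.assoc del: upt_Suc)
    finally show ?thesis
    proof (rule cspan_cong_mem)
      have gi: "g (Suc ?i) \<in> monomials {1..<n}"
        using less.prems 3 assms(2) by (intro gen_in_monomials) auto
      show "g (Suc ?i) * (e 1 * g_word [1..<Suc (Suc l)] * e r)
        - \<epsilon> *s (e 1 * g_word [1..<Suc (Suc l)] * e r - g (Suc ?i) * (e 1 * ?P * e r)) \<in> ?L"
        by (intro cspan_diff cspan_scale stable[OF gi] IH)
    qed
  qed
qed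

lemma ideal_sum_cong_mem: "x \<asymp> y \<Longrightarrow> y \<in> ideal_sum \<Longrightarrow> x \<in> ideal_sum"
  unfolding ideal_sum_def by (rule cspan_cong_mem)

lemma ideal_sum_diff: "x \<in> ideal_sum \<Longrightarrow> y \<in> ideal_sum \<Longrightarrow> x - y \<in> ideal_sum"
  and ideal_sum_scale: "x \<in> ideal_sum \<Longrightarrow> c *s x \<in> ideal_sum"
  unfolding ideal_sum_def by (auto intro: cspan_diff cspan_scale)

text \<open>
  For $i=r$ this is the recursion for the idempotents, which produces $e_{(r+1)}$. For $i<r$ a
  factor $e_{(i)}$ is split off $e_{(r)}$ and moved to the left next to $g_i$; then $e_{(i)}g_ie_{(i)}$ is a combination of $e_{(i)}$ and $e_{(i+1)}$.
\<close>

lemma e_chain_e: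
  assumes "1 \<le> i" "i \<le> r" "r < n"
  shows "e i * g_word [i..<Suc r] * e r \<in> ideal_sum"
  using assms(1,2)
proof (induction "r - i" arbitrary: i)
  case 0
  then have i: "i = r" by simp
  have "e r * g r * e r \<asymp> \<gamma> *s e r - \<epsilon> *s e (Suc r)" using 0 assms(3) by (intro e_g_e) auto
  then have "e r * g r * e r \<in> ideal_sum"
    using assms(3)
    by (rule_tac ideal_sum_cong_mem) (auto intro!: ideal_sum_diff ideal_sum_scale e_in_ideal_sum)
  then show ?case using i by simp
next
  case (Suc d)
  let ?Q = "g_word [Suc i..<Suc r]"
  have chain: "g_word [i..<Suc r] = g i * ?Q"
    using Suc by (simp add: upt_conv_Cons[of i] del: upt_Suc)
  have absorb: "e i * e r \<asymp> e r" using Suc assms(3) by (intro e_absorb) auto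
  have far: "e i * ?Q \<asymp> ?Q * e i"
    using assms(3) by (intro e_far_monomials[of _ "{Suc i..<Suc r}"] g_word_in_monomials) auto
  have "e i * g_word [i..<Suc r] * e r = e i * g i * ?Q * e r"
    unfolding chain by (simp add: mult.assoc del: upt_Suc)
  also have "\<dots> \<asymp> e i * g i * ?Q * (e i * e r)" by (intro cong_mult_left cong_sym[OF absorb])
  also have "\<dots> = e i * g i * (?Q * e i) * e r" by (simp add: mult.assoc del: upt_Suc)
  also have "\<dots> \<asymp> e i * g i * (e i * ?Q) * e r"
    by (intro cong_mult_left cong_mult_right cong_sym[OF far])
  also have "\<dots> = e i * g i * e i * (?Q * e r)" by (simp add: mult.assoc del: upt_Suc)
  also have "\<dots> \<asymp> (\<gamma> *s e i - \<epsilon> *s e (Suc i)) * (?Q * e r)"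
    using Suc assms(3) by (intro cong_mult_right e_g_e) auto
  also have "\<dots> = \<gamma> *s (e i * ?Q * e r) - \<epsilon> *s (e (Suc i) * ?Q * e r)"
    by (simp add: left_diff_distrib scale_mult_left mult.assoc del: upt_Suc)
  also have "\<dots> \<asymp> \<gamma> *s (?Q * e i * e r) - \<epsilon> *s (e (Suc i) * ?Q * e r)"
    by (intro cong_diff cong_scale cong_mult_right far cong_refl)
  also have "\<dots> = \<gamma> *s (?Q * (e i * e r)) - \<epsilon> *s (e (Suc i) * ?Q * e r)"
    by (simp add: mult.assoc del: upt_Suc)
  also have "\<dots> \<asymp> \<gamma> *s (?Q * e r) - \<epsilon> *s (e (Suc i) * ?Q * e r)"
    by (intro cong_diff cong_scale cong_mult_left absorb cong_refl)
  finally show ?case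
  proof (rule ideal_sum_cong_mem)
    have "?Q * e r \<in> ideal_sum"
      using assms(3) by (intro ideal_sum_mult_left g_word_in_monomials e_in_ideal_sum) auto
    moreover have "e (Suc i) * ?Q * e r \<in> ideal_sum" using Suc by auto
    ultimately show "\<gamma> *s (?Q * e r) - \<epsilon> *s (e (Suc i) * ?Q * e r) \<in> ideal_sum"
      by (intro ideal_sum_diff ideal_sum_scale)
  qed
qed

text \<open>
  Apart from letters that commute with \<open>e 1\<close>, the factor between \<open>e 1\<close> and \<open>e r\<close> is a
  chain $g_1\cdots g_{k-1}$. The letters beyond \<open>r\<close> commute with \<open>e r\<close> and leave to the right.
\<close>

lemma e1_ideal_sum:
  assumes "1 \<le> n" "x \<in> ideal_sum"
  shows "e 1 * x \<in> ideal_sum"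
proof (rule ideal_sum_left[OF _ assms(2)])
  fix r a b
  assume r: "r \<le> n" and ab: "a \<in> monomials {1..<n}" "b \<in> monomials {1..<n}"
  have "e 1 * a * e r \<in> ideal_sum"
  proof (cases "r = 0")
    case True
    then show ?thesis
      using ideal_sum_mult_right[OF e_in_ideal_sum[of 1] ab(1)] assms(1) by (simp add: e_0)
  next
    case False
    have "a \<in> cspan (monomials {2..<n} * (\<Union>k\<in>{1..n}. {g_word [1..<k]}))"
      using cspan_monomials_tail[OF assms(1)] ab(1) cspan_base by blast
    then show ?thesis unfolding ideal_sum_def
    proof (rule cspan_sandwich)
      fix y assume "y \<in> monomials {2..<n} * (\<Union>k\<in>{1..n}. {g_word [1..<k]})"
      then obtain c k where y: "c \<in> monomials {2..<n}" "1 \<le> k" "k \<le> n" "y = c * g_word [1..<k]"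
        by (auto elim!: set_times_elim)
      have far: "e 1 * c \<asymp> c * e 1" using y(1) by (rule e_far_monomials) auto
      have "e 1 * y * e r \<asymp> c * (e 1 * g_word [1..<k] * e r)"
        using cong_mult_right[OF far, of "g_word [1..<k] * e r"] y(4) by (simp add: mult.assoc)
      moreover have "e 1 * g_word [1..<k] * e r \<in> ideal_sum"
      proof (cases "k \<le> r")
        case True
        then obtain l where "k = Suc l" "l < r" using y(2) by (cases k) auto
        then show ?thesis
          using e1_chain_e[of l r] cspan_monomials_e_in_ideal_sum[of r] r by blast
      next
        case False
        then have "[1..<k] = [1..<Suc r] @ [Suc r..<k]"
          using upt_add_eq_append[of 1 "Suc r" "k - Suc r"] by (simp del: upt_Suc)
        then have "e 1 * g_word [1..<k] * e r = e 1 * g_word [1..<Suc r] * (g_word [Suc r..<k] * e r)"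
          by (simp add: mult.assoc del: upt_Suc)
        also have "\<dots> \<asymp> e 1 * g_word [1..<Suc r] * (e r * g_word [Suc r..<k])"
          using y(3)
          by (intro cong_mult_left cong_sym[OF e_far_monomials[of _ "{Suc r..<k}"]] g_word_in_monomials)
            auto
        also have "\<dots> = e 1 * g_word [1..<Suc r] * e r * g_word [Suc r..<k]" by (simp add: mult.assoc)
        finally have "e 1 * g_word [1..<k] * e r \<asymp> e 1 * g_word [1..<Suc r] * e r * g_word [Suc r..<k]" .
        moreover have "e 1 * g_word [1..<Suc r] * e r * g_word [Suc r..<k] \<in> ideal_sum"
          using False \<open>r \<noteq> 0\<close> y(3)
          by (intro ideal_sum_mult_right e_chain_e g_word_in_monomials) auto
        ultimately show ?thesis by (rule ideal_sum_cong_mem)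
      qed
      then have "c * (e 1 * g_word [1..<k] * e r) \<in> ideal_sum"
        using y(1) monomials_subset[of "{2..<n}" "{1..<n}"] ideal_sum_mult_left[of c] by auto
      ultimately have "e 1 * y * e r \<in> ideal_sum" by (rule ideal_sum_cong_mem)
      then show "e 1 * y * e r \<in> cspan (\<Union>r\<in>{0..n}. monomials {1..<n} * {e r} * monomials {1..<n})"
        unfolding ideal_sum_def .
    qed
  qed
  from ideal_sum_mult_right[OF this ab(2)] show "e 1 * (a * e r * b) \<in> ideal_sum"
    by (simp add: mult.assoc)
qed

text \<open>
  The other idempotents are polynomials in \<open>e 1\<close> and the generators of the Hecke algebra.
\<close>

theorem e_ideal_sum:
  assumes "r \<le> n" "x \<in> ideal_sum"
  shows "e r * x \<in> ideal_sum"
proof (cases "r = 0")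
  case True
  then show ?thesis using assms(2) by (simp add: e_0)
next
  case False
  then have "1 \<le> r" by simp
  then show ?thesis using assms
  proof (induction r arbitrary: x rule: dec_induct)
    case base
    then show ?case by (intro e1_ideal_sum) auto
  next
    case (step r)
    have IH: "e r * y \<in> ideal_sum" if "y \<in> ideal_sum" for y using step that by auto
    have "e (Suc r) * x \<asymp> \<epsilon> *s (\<gamma> *s e r - e r * g r * e r) * x"
      using step by (intro cong_mult_right e_Suc) auto
    also have "\<dots> = \<epsilon> *s (\<gamma> *s (e r * x) - e r * (g r * (e r * x)))"
      by (simp add: scale_mult_left left_diff_distrib mult.assoc)
    finally show ?case
    proof (rule ideal_sum_cong_mem)
      have "g r \<in> monomials {1..<n}" using step by (intro gen_in_monomials) auto
      then show "\<epsilon> *s (\<gamma> *s (e r * x) - e r * (g r * (e r * x))) \<in> ideal_sum"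
        using step.prems by (intro ideal_sum_scale ideal_sum_diff IH ideal_sum_mult_left)
    qed
  qed
qed

theorem ideal_sum_UNIV:
  assumes gen: "\<And>T. subspace T \<Longrightarrow> 1 \<in> T \<Longrightarrow> K \<subseteq> T \<Longrightarrow>
      (\<And>i x. 1 \<le> i \<Longrightarrow> i < n \<Longrightarrow> x \<in> T \<Longrightarrow> g i * x \<in> T) \<Longrightarrow>
      (\<And>r x. 1 \<le> r \<Longrightarrow> r \<le> n \<Longrightarrow> x \<in> T \<Longrightarrow> e r * x \<in> T) \<Longrightarrow> T = UNIV"
  shows "ideal_sum = UNIV"
proof (rule gen)
  show "1 \<in> ideal_sum" using e_in_ideal_sum[of 0] by (simp add: e_0)
  show "g i * x \<in> ideal_sum" if "1 \<le> i" "i < n" "x \<in> ideal_sum" for i x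
    using that by (intro ideal_sum_mult_left gen_in_monomials) auto
  show "e r * x \<in> ideal_sum" if "r \<le> n" "x \<in> ideal_sum" for r x
    using that by (rule e_ideal_sum)
qed (auto simp: ideal_sum_def subspace_cspan ideal_in_cspan)

end

section \<open>Free algebras and algebras given by relations\<close>

definition word_monom :: "'x list \<Rightarrow> 'x word \<Rightarrow>\<^sub>0 'k::field"
  where "word_monom x = Poly_Mapping.single (Word x) 1"

lemma word_monom_mult: "word_monom x * word_monom y = word_monom (x @ y)"
  by (simp add: word_monom_def mult_single plus_word_def)

lemma word_monom_Nil: "word_monom [] = 1"
  by (simp add: word_monom_def flip: zero_word_def)

lemma const_mult_monom: "const c * word_monom x = Poly_Mapping.single (Word x) c"
  by (simp add: word_monom_def const_def mult_single plus_word_def zero_word_def)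

lemma free_algebra_induct [case_names zero add word_monom]:
  assumes "P 0" and add: "\<And>f g. P f \<Longrightarrow> P g \<Longrightarrow> P (f + g)" and "\<And>c x. P (const c * word_monom x)"
  shows "P (f :: 'x word \<Rightarrow>\<^sub>0 'k::field)"
proof (induction f rule: update_induct)
  case const
  then show ?case by fact
next
  case (update f w b)
  have "Poly_Mapping.update w b f = f + Poly_Mapping.single w b"
    using update(1)
    by (intro poly_mapping_eqI) (auto simp: lookup_update lookup_add lookup_single in_keys_iff when_def)
  moreover have "P (Poly_Mapping.single w b)"
    using assms(3)[of b "letters w"] by (simp add: const_mult_monom)
  ultimately show ?case using add update by simp
qed

lemma const_add: "const (c + d) = const c + const d"
  and const_mult: "const (c * d) = const c * const d"
  and const_one: "const 1 = 1"
  and const_zero: "const 0 = 0"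
  by (simp_all add: const_def single_add mult_single)

lemma const_diff: "const (c - d) = const c - const d"
  by (simp add: const_def single_diff)

lemma const_uminus: "const (- c) = - const c"
  by (simp add: const_def single_uminus)

lemma uminus_eq_const_mult: "- f = const (- 1) * f"
  by (simp add: const_uminus const_one)

lemma var_eq_monom: "var x = word_monom [x]"
  by (simp add: var_def word_monom_def)

lemma const_commute: "x * const c = const c * x"
proof (induction x rule: free_algebra_induct)
  case (word_monom d x)
  have "word_monom x * const c = const c * word_monom x" for x :: "'a list"
    by (simp add: word_monom_def const_def mult_single plus_word_def zero_word_def)
  then show ?case by (simp add: mult.assoc) (simp add: mult.commute flip: mult.assoc const_mult)
qed (simp_all add: algebra_simps)

lemma const_mult_mult: "const c * x * (const d * y) = const (c * d) * (x * y)"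
proof -
  have "const c * x * (const d * y) = const c * (x * const d) * y" by (simp add: mult.assoc)
  also have "\<dots> = const (c * d) * (x * y)" by (simp add: const_commute[of x] const_mult mult.assoc)
  finally show ?thesis .
qed

text \<open>
  The linear map that is given by \<open>\<phi>\<close> on the basis of words.
\<close>

definition lin_ext :: "('x list \<Rightarrow> 'y word \<Rightarrow>\<^sub>0 'k) \<Rightarrow> ('x word \<Rightarrow>\<^sub>0 'k::field) \<Rightarrow> 'y word \<Rightarrow>\<^sub>0 'k"
  where "lin_ext \<phi> f = (\<Sum>w\<in>Poly_Mapping.keys f. const (Poly_Mapping.lookup f w) * \<phi> (letters w))"

lemma lin_ext_add: "lin_ext \<phi> (f + g) = lin_ext \<phi> f + lin_ext \<phi> g"
  unfolding lin_ext_def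
  by (rule setsum_keys_plus_distrib) (simp_all add: const_zero const_add distrib_right)

lemma lin_ext_zero: "lin_ext \<phi> 0 = 0"
  by (simp add: lin_ext_def)

lemma lin_ext_monom: "lin_ext \<phi> (const c * word_monom x) = const c * \<phi> x"
  by (simp add: lin_ext_def const_mult_monom const_zero)

lemma lin_ext_monom': "lin_ext \<phi> (word_monom x) = \<phi> x"
  using lin_ext_monom[of \<phi> 1 x] by (simp add: const_one)

lemma lin_ext_const: "lin_ext \<phi> (const c * f) = const c * lin_ext \<phi> f"
  by (induction f rule: free_algebra_induct)
    (simp_all add: lin_ext_zero lin_ext_add distrib_left lin_ext_monom flip: mult.assoc const_mult)

lemma lin_ext_uminus: "lin_ext \<phi> (- f) = - lin_ext \<phi> f"
  using lin_ext_add[of \<phi> f "- f"] by (simp add: lin_ext_zero add_eq_0_iff2)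

lemma lin_ext_diff: "lin_ext \<phi> (f - g) = lin_ext \<phi> f - lin_ext \<phi> g"
  using lin_ext_add[of \<phi> f "- g"] by (simp add: lin_ext_uminus)

lemma lin_ext_mult:
  assumes "\<And>x y. \<phi> (x @ y) = \<phi> x * \<phi> y"
  shows "lin_ext \<phi> (f * g) = lin_ext \<phi> f * lin_ext \<phi> g"
proof (induction f rule: free_algebra_induct)
  case (word_monom c x)
  show ?case
  proof (induction g rule: free_algebra_induct)
    case (word_monom d y)
    show ?case by (simp add: const_mult_mult word_monom_mult lin_ext_monom assms)
  qed (simp_all add: lin_ext_zero lin_ext_add distrib_left)
qed (simp_all add: lin_ext_zero lin_ext_add distrib_right)

lemma lin_ext_mult_rev:
  assumes "\<And>x y. \<phi> (x @ y) = \<phi> y * \<phi> x"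
  shows "lin_ext \<phi> (f * g) = lin_ext \<phi> g * lin_ext \<phi> f"
proof (induction f rule: free_algebra_induct)
  case (word_monom c x)
  show ?case
  proof (induction g rule: free_algebra_induct)
    case (word_monom d y)
    show ?case by (simp add: const_mult_mult word_monom_mult lin_ext_monom assms mult.commute[of d])
  qed (simp_all add: lin_ext_zero lin_ext_add distrib_left distrib_right)
qed (simp_all add: lin_ext_zero lin_ext_add distrib_left distrib_right)

definition rev_word :: "('x word \<Rightarrow>\<^sub>0 'k::field) \<Rightarrow> 'x word \<Rightarrow>\<^sub>0 'k"
  where "rev_word = lin_ext (\<lambda>x. word_monom (rev x))"

lemma rev_word_add: "rev_word (f + g) = rev_word f + rev_word g"
  and rev_word_diff: "rev_word (f - g) = rev_word f - rev_word g"
  and rev_word_zero: "rev_word 0 = 0"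
  and rev_word_const_mult: "rev_word (const c * f) = const c * rev_word f"
  and rev_word_monom: "rev_word (word_monom x) = word_monom (rev x)"
  by (simp_all add: rev_word_def lin_ext_add lin_ext_diff lin_ext_zero lin_ext_const lin_ext_monom')

lemma rev_word_mult: "rev_word (f * g) = rev_word g * rev_word f"
  unfolding rev_word_def by (rule lin_ext_mult_rev) (simp add: word_monom_mult)

lemma rev_word_one: "rev_word 1 = 1"
  using rev_word_monom[of "[]"] by (simp add: word_monom_Nil)

lemma rev_word_const: "rev_word (const c) = const c"
  using rev_word_const_mult[of c 1] by (simp add: rev_word_one)

lemma rev_word_var: "rev_word (var x) = var x"
  by (simp add: var_eq_monom rev_word_monom)

text \<open>
  The retraction of the free algebra on the whole type onto the free algebra on \<open>X\<close>. Composed with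
  it, the projection onto an algebra presented by generators in \<open>X\<close> becomes a homomorphism that is
  defined on a full type, with the letters outside \<open>X\<close> as additional relators.
\<close>

definition kill_outside :: "'x set \<Rightarrow> ('x word \<Rightarrow>\<^sub>0 'k::field) \<Rightarrow> 'x word \<Rightarrow>\<^sub>0 'k"
  where "kill_outside X = lin_ext (\<lambda>x. if set x \<subseteq> X then word_monom x else 0)"

lemma kill_outside_add: "kill_outside X (f + g) = kill_outside X f + kill_outside X g"
  and kill_outside_diff: "kill_outside X (f - g) = kill_outside X f - kill_outside X g"
  and kill_outside_zero: "kill_outside X 0 = 0"
  and kill_outside_const_mult: "kill_outside X (const c * f) = const c * kill_outside X f"
  and kill_outside_monom: "kill_outside X (word_monom x) = (if set x \<subseteq> X then word_monom x else 0)"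
  by (simp_all add: kill_outside_def lin_ext_add lin_ext_diff lin_ext_zero lin_ext_const lin_ext_monom')

lemma kill_outside_mult: "kill_outside X (f * g) = kill_outside X f * kill_outside X g"
  unfolding kill_outside_def by (rule lin_ext_mult) (simp add: word_monom_mult)

lemma kill_outside_rev_word: "kill_outside X (rev_word f) = rev_word (kill_outside X f)"
  by (induction f rule: free_algebra_induct)
    (simp_all add: kill_outside_add kill_outside_zero kill_outside_const_mult kill_outside_monom
      rev_word_add rev_word_zero rev_word_const_mult rev_word_monom)

lemma free_algebra_simps:
  "monoid.mult (free_algebra X) = (*)" "monoid.one (free_algebra X) = 1"
  "ring.zero (free_algebra X) = 0" "ring.add (free_algebra X) = (+)"
  by (simp_all add: free_algebra_def)

lemma carrier_free_algebra:
  "carrier (free_algebra X) = {f. \<forall>w\<in>Poly_Mapping.keys f. set (letters w) \<subseteq> X}"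
  by (simp add: free_algebra_def)

lemma carrier_zero: "0 \<in> carrier (free_algebra X)"
  and carrier_one: "1 \<in> carrier (free_algebra X)"
  and carrier_const: "const c \<in> carrier (free_algebra X)"
  by (simp_all add: carrier_free_algebra const_def zero_word_def)

lemma carrier_monom: "set x \<subseteq> X \<Longrightarrow> word_monom x \<in> carrier (free_algebra X)"
  by (simp add: carrier_free_algebra word_monom_def)

lemma carrier_var: "x \<in> X \<Longrightarrow> var x \<in> carrier (free_algebra X)"
  by (simp add: carrier_free_algebra var_def)

lemma carrier_add:
  "f \<in> carrier (free_algebra X) \<Longrightarrow> g \<in> carrier (free_algebra X) \<Longrightarrow> f + g \<in> carrier (free_algebra X)"
  using keys_add[of f g] by (auto simp: carrier_free_algebra)

lemma carrier_mult:
  "f \<in> carrier (free_algebra X) \<Longrightarrow> g \<in> carrier (free_algebra X) \<Longrightarrow> f * g \<in> carrier (free_algebra X)"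
  using keys_mult[of f g] by (fastforce simp: carrier_free_algebra plus_word_def)

lemma carrier_uminus: "f \<in> carrier (free_algebra X) \<Longrightarrow> - f \<in> carrier (free_algebra X)"
  using carrier_mult[OF carrier_const[of "- 1"], of f X] by (simp add: uminus_eq_const_mult)

lemma carrier_diff:
  "f \<in> carrier (free_algebra X) \<Longrightarrow> g \<in> carrier (free_algebra X) \<Longrightarrow> f - g \<in> carrier (free_algebra X)"
  using carrier_add[OF _ carrier_uminus, of f X g] by simp

lemmas carrier_intros = carrier_zero carrier_one carrier_const carrier_var carrier_add
  carrier_mult carrier_diff carrier_uminus

lemma ring_free_algebra: "ring (free_algebra X)"
proof (rule ringI)
  show "abelian_group (free_algebra X)"
  proof (rule abelian_groupI, unfold free_algebra_simps)
    fix f assume "f \<in> carrier (free_algebra X)"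
    then show "\<exists>g\<in>carrier (free_algebra X). g + f = 0"
      by (intro bexI[of _ "- f"] carrier_uminus) simp
  qed (simp_all add: carrier_add carrier_zero add.assoc add.commute)
  show "monoid (free_algebra X)"
    by (rule monoidI, unfold free_algebra_simps) (simp_all add: carrier_mult carrier_one mult.assoc)
qed (simp_all add: free_algebra_simps distrib_left distrib_right)

lemma a_minus_free_algebra:
  assumes "f \<in> carrier (free_algebra X)" "g \<in> carrier (free_algebra X)"
  shows "f \<ominus>\<^bsub>free_algebra X\<^esub> g = f - g"
proof -
  interpret ring "free_algebra X" by (rule ring_free_algebra)
  have "\<ominus>\<^bsub>free_algebra X\<^esub> g = - g"
    using assms(2) carrier_uminus[OF assms(2)] by (intro minus_equality) (simp_all add: free_algebra_simps)
  then show ?thesis by (simp add: a_minus_def free_algebra_simps)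
qed

lemma kill_outside_carrier: "kill_outside X f \<in> carrier (free_algebra X)"
  by (induction f rule: free_algebra_induct)
    (auto simp: kill_outside_zero kill_outside_add kill_outside_const_mult kill_outside_monom
      intro!: carrier_intros carrier_monom)

lemma kill_outside_id:
  assumes "f \<in> carrier (free_algebra X)" shows "kill_outside X f = f"
proof -
  have "kill_outside X f = lin_ext word_monom f"
    using assms unfolding kill_outside_def lin_ext_def carrier_free_algebra by (intro sum.cong) auto
  also have "lin_ext word_monom f = f"
    by (induction f rule: free_algebra_induct) (simp_all add: lin_ext_zero lin_ext_add lin_ext_monom)
  finally show ?thesis .
qed

lemma carrier_induct [consumes 1, case_names zero add word_monom]:
  assumes f: "f \<in> carrier (free_algebra X)"
    and "P 0" "\<And>f g. P f \<Longrightarrow> P g \<Longrightarrow> P (f + g)"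
    and "\<And>c x. set x \<subseteq> X \<Longrightarrow> P (const c * word_monom x)"
  shows "P (f :: 'x word \<Rightarrow>\<^sub>0 'k::field)"
proof -
  have "P (kill_outside X f)" for f
    by (induction f rule: free_algebra_induct)
      (use assms in \<open>auto simp: kill_outside_zero kill_outside_add kill_outside_const_mult kill_outside_monom\<close>)
  then show ?thesis using kill_outside_id[OF f] by metis
qed

lemma vector_space_const: "vector_space (\<lambda>c (x :: 'x word \<Rightarrow>\<^sub>0 'k::field). const c * x)"
  by standard (simp_all add: distrib_left distrib_right const_add const_mult const_one mult.assoc)

text \<open>
  The map \<open>quo\<close> makes the presented algebra a quotient of the free algebra on the whole type, and
  \<open>rel_ideal\<close> is its kernel.
\<close>

locale presentation =
  fixes X :: "'x set" and R :: "('x word \<Rightarrow>\<^sub>0 'k::field) set"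
  assumes relators: "R \<subseteq> carrier (free_algebra X)"
begin

abbreviation F :: "('x word \<Rightarrow>\<^sub>0 'k) ring" where "F \<equiv> free_algebra X"
abbreviation I where "I \<equiv> genideal F R"
abbreviation P where "P \<equiv> presented_algebra X R"

definition quo :: "('x word \<Rightarrow>\<^sub>0 'k) \<Rightarrow> ('x word \<Rightarrow>\<^sub>0 'k) set"
  where "quo x = proj X R (kill_outside X x)"

definition rel_ideal :: "('x word \<Rightarrow>\<^sub>0 'k) set"
  where "rel_ideal = {x. kill_outside X x \<in> I}"

lemma ideal_I: "ideal I F"
  using ring.genideal_ideal[OF ring_free_algebra relators] .

lemma zero_in_I: "0 \<in> I"
  and add_in_I: "x \<in> I \<Longrightarrow> y \<in> I \<Longrightarrow> x + y \<in> I"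
  using additive_subgroup.zero_closed additive_subgroup.a_closed ideal.axioms(1)[OF ideal_I]
  by (fastforce simp: free_algebra_simps)+

lemma quo_carrier: "f \<in> carrier F \<Longrightarrow> quo f = proj X R f"
  by (simp add: quo_def kill_outside_id)

lemma P_simps:
  "carrier P = carrier (F Quot I)" "monoid.mult P = monoid.mult (F Quot I)" "monoid.one P = monoid.one (F Quot I)"
  "ring.zero P = ring.zero (F Quot I)" "ring.add P = ring.add (F Quot I)"
  "module.smult P c x = proj X R (const c) \<otimes>\<^bsub>F Quot I\<^esub> x"
  by (simp_all add: presented_algebra_def Let_def ring.defs module.defs)

lemma proj_hom: "proj X R \<in> ring_hom F (F Quot I)"
  unfolding proj_def using ideal.rcos_ring_hom[OF ideal_I] by simp

lemma quo_add: "quo (x + y) = quo x \<oplus>\<^bsub>P\<^esub> quo y"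
  and quo_mult: "quo (x * y) = quo x \<otimes>\<^bsub>P\<^esub> quo y"
  and quo_one: "quo 1 = \<one>\<^bsub>P\<^esub>"
  and quo_scale: "quo (const c * x) = c \<odot>\<^bsub>P\<^esub> quo x"
proof -
  note h = proj_hom[unfolded ring_hom_def]
  show "quo (x + y) = quo x \<oplus>\<^bsub>P\<^esub> quo y"
    using h kill_outside_carrier[of X x] kill_outside_carrier[of X y]
    by (simp add: quo_def P_simps kill_outside_add free_algebra_simps)
  show "quo (x * y) = quo x \<otimes>\<^bsub>P\<^esub> quo y"
    using h kill_outside_carrier[of X x] kill_outside_carrier[of X y]
    by (simp add: quo_def P_simps kill_outside_mult free_algebra_simps)
  show "quo 1 = \<one>\<^bsub>P\<^esub>"
    using h by (simp add: quo_def P_simps kill_outside_id carrier_one free_algebra_simps)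
  show "quo (const c * x) = c \<odot>\<^bsub>P\<^esub> quo x"
    using h kill_outside_carrier[of X x] carrier_const[of c X]
    by (simp add: quo_def P_simps kill_outside_const_mult free_algebra_simps)
qed

lemma quo_eq_iff: "quo x = quo y \<longleftrightarrow> x - y \<in> rel_ideal"
proof -
  have "quo x = quo y \<longleftrightarrow> kill_outside X x \<ominus>\<^bsub>F\<^esub> kill_outside X y \<in> I"
    using ring.quotient_eq_iff_same_a_r_cos[OF ring_free_algebra ideal_I
        kill_outside_carrier kill_outside_carrier]
    by (simp add: quo_def proj_def)
  then show ?thesis
    by (simp add: a_minus_free_algebra kill_outside_carrier rel_ideal_def kill_outside_diff)
qed

lemma carrier_P: "carrier P = range quo"
proof -
  have "carrier (F Quot I) = proj X R ` carrier F"
    by (auto simp: FactRing_def A_RCOSETS_def' proj_def)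
  also have "\<dots> = range quo"
    using quo_carrier kill_outside_carrier by (force simp: quo_def)
  finally show ?thesis by (simp add: P_simps)
qed

lemma quo_zero: "quo 0 = \<zero>\<^bsub>P\<^esub>"
proof -
  interpret Q: ring "F Quot I" using ideal.quotient_is_ring[OF ideal_I] .
  have "quo 0 \<in> carrier (F Quot I)" using carrier_P P_simps by auto
  moreover have "quo 0 \<oplus>\<^bsub>F Quot I\<^esub> quo 0 = quo 0" using quo_add[of 0 0] by (simp add: P_simps)
  ultimately show ?thesis unfolding P_simps by (simp add: Q.add.l_cancel_one')
qed

lemma abelian_monoid_P: "abelian_monoid P"
proof (rule abelian_monoidI)
  show "x \<oplus>\<^bsub>P\<^esub> y \<oplus>\<^bsub>P\<^esub> z = x \<oplus>\<^bsub>P\<^esub> (y \<oplus>\<^bsub>P\<^esub> z)"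
    if "x \<in> carrier P" "y \<in> carrier P" "z \<in> carrier P" for x y z
    using that by (auto simp: carrier_P add.assoc simp flip: quo_add)
qed (auto simp: carrier_P add.commute simp flip: quo_zero quo_add)

lemma rel_ideal_subspace: "module.subspace (\<lambda>c x. const c * x) rel_ideal"
proof -
  interpret vector_space "\<lambda>c (x :: 'x word \<Rightarrow>\<^sub>0 'k). const c * x" by (rule vector_space_const)
  interpret ideal I F by (rule ideal_I)
  show ?thesis
    using I_l_closed zero_in_I add_in_I
    by (intro subspaceI)
      (auto simp: rel_ideal_def kill_outside_zero kill_outside_add kill_outside_const_mult
        free_algebra_simps carrier_const)
qed

lemma rel_ideal_mult: "x \<in> rel_ideal \<Longrightarrow> y * x \<in> rel_ideal" "x \<in> rel_ideal \<Longrightarrow> x * y \<in> rel_ideal"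
  using ideal.I_l_closed[OF ideal_I] ideal.I_r_closed[OF ideal_I] kill_outside_carrier[of X y]
  by (auto simp: rel_ideal_def kill_outside_mult free_algebra_simps)

lemma relator_in_rel_ideal: "x \<in> R \<Longrightarrow> x \<in> rel_ideal"
  using ring.genideal_self[OF ring_free_algebra relators] relators
  by (simp add: rel_ideal_def kill_outside_id subset_iff)

lemma outside_in_rel_ideal: "x \<notin> X \<Longrightarrow> var x \<in> rel_ideal"
  using zero_in_I by (simp add: rel_ideal_def var_eq_monom kill_outside_monom)

text \<open>
  The elements of the ideal whose reversal lies in it form an ideal, which contains the relators.
\<close>

lemma rev_word_rel_ideal:
  assumes "\<And>x. x \<in> R \<Longrightarrow> rev_word x \<in> R \<or> - rev_word x \<in> R" "x \<in> rel_ideal"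
  shows "rev_word x \<in> rel_ideal"
proof -
  interpret I: ideal I F by (rule ideal_I)
  let ?J = "{x \<in> carrier F. rev_word x \<in> I}"
  have neg: "- x \<in> I" if "x \<in> I" for x
    using I.I_l_closed[OF that carrier_const[of "- 1"]]
    by (simp add: free_algebra_simps uminus_eq_const_mult)
  have rev_carrier: "rev_word x \<in> carrier F" if "x \<in> carrier F" for x
    using kill_outside_carrier[of X "rev_word x"] kill_outside_rev_word[of X x]
    by (simp add: kill_outside_id[OF that])
  have "ideal ?J F"
  proof (rule idealI[OF ring_free_algebra])
    show "subgroup ?J (add_monoid F)"
    proof (rule group.subgroupI)
      show "Group.group (add_monoid F)"
        using ring.is_abelian_group[OF ring_free_algebra] abelian_group.a_group by blast
      show "?J \<noteq> {}" using zero_in_I carrier_zero by (auto simp: rev_word_zero intro!: exI[of _ 0])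
      fix a b assume ab: "a \<in> ?J" "b \<in> ?J"
      then show "a \<otimes>\<^bsub>add_monoid F\<^esub> b \<in> ?J"
        using add_in_I by (auto simp: rev_word_add free_algebra_simps carrier_add)
      have "inv\<^bsub>add_monoid F\<^esub> a = - a"
        using a_minus_free_algebra[OF carrier_zero, of a X] ab
        by (simp add: a_minus_def a_inv_def free_algebra_simps)
      then show "inv\<^bsub>add_monoid F\<^esub> a \<in> ?J"
        using ab neg rev_word_diff[of 0 a] by (simp add: carrier_uminus rev_word_zero)
    qed auto
  next
    fix a x assume "a \<in> ?J" "x \<in> carrier F"
    then show "x \<otimes>\<^bsub>F\<^esub> a \<in> ?J" "a \<otimes>\<^bsub>F\<^esub> x \<in> ?J"
      using I.I_l_closed I.I_r_closed rev_carrier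
      by (auto simp: rev_word_mult free_algebra_simps carrier_mult)
  qed
  moreover have "R \<subseteq> ?J"
  proof
    fix x assume x: "x \<in> R"
    have "R \<subseteq> I" using ring.genideal_self[OF ring_free_algebra relators] .
    then have "rev_word x \<in> I" using assms(1)[OF x] neg[of "- rev_word x"] by auto
    then show "x \<in> ?J" using x relators by auto
  qed
  ultimately have "I \<subseteq> ?J" by (rule ring.genideal_minimal[OF ring_free_algebra])
  then show ?thesis using assms(2) by (auto simp: rel_ideal_def kill_outside_rev_word)
qed

text \<open>
  A combination of the images of \<open>S\<close> adds up coefficients at elements with the same image, so a
  summand whose image already occurs has to be merged with the existing one.
\<close>

lemma lspan_quo:
  "lspan P (quo ` S) = quo ` module.span (\<lambda>c x. const c * x) S"
proof -
  interpret vector_space "\<lambda>c (x :: 'x word \<Rightarrow>\<^sub>0 'k). const c * x" by (rule vector_space_const)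
  interpret abelian_monoid P by (rule abelian_monoid_P)
  have quoP: "quo x \<in> carrier P" for x by (simp add: carrier_P)
  have smultP: "c \<odot>\<^bsub>P\<^esub> quo x \<in> carrier P" for c x by (simp add: carrier_P flip: quo_scale)
  show ?thesis
  proof
    have "finite t \<Longrightarrow> t \<subseteq> quo ` S \<Longrightarrow> (\<Oplus>\<^bsub>P\<^esub>a\<in>t. c a \<odot>\<^bsub>P\<^esub> a) \<in> quo ` span S" for t c
    proof (induction t rule: finite_induct)
      case empty
      then show ?case using span_zero by (auto simp flip: quo_zero)
    next
      case (insert a t)
      obtain s where s: "s \<in> S" "a = quo s" using insert by auto
      obtain y where y: "y \<in> span S" "(\<Oplus>\<^bsub>P\<^esub>a\<in>t. c a \<odot>\<^bsub>P\<^esub> a) = quo y" using insert by auto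
      have "(\<Oplus>\<^bsub>P\<^esub>a\<in>insert a t. c a \<odot>\<^bsub>P\<^esub> a) = c a \<odot>\<^bsub>P\<^esub> a \<oplus>\<^bsub>P\<^esub> quo y"
        using insert smultP y by (subst finsum_insert) (auto simp: Pi_iff)
      also have "\<dots> = quo (const (c a) * s + y)" by (simp add: s quo_add quo_scale)
      finally have "(\<Oplus>\<^bsub>P\<^esub>a\<in>insert a t. c a \<odot>\<^bsub>P\<^esub> a) = quo (const (c a) * s + y)" .
      moreover have "const (c a) * s + y \<in> span S"
        by (rule span_add[OF span_scale[OF span_base[OF s(1)]] y(1)])
      ultimately show ?case by (rule image_eqI)
    qed
    then show "lspan P (quo ` S) \<subseteq> quo ` span S" by (auto simp: lspan_def)
    have "quo x \<in> lspan P (quo ` S)" if "x \<in> span S" for x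
      using that
    proof (induction x rule: span_induct_alt)
      case base
      have "quo 0 = (\<Oplus>\<^bsub>P\<^esub>a\<in>{}. 0 \<odot>\<^bsub>P\<^esub> a)" by (simp add: quo_zero)
      then show ?case
        unfolding lspan_def by (intro CollectI exI[of _ "{}"] exI[of _ "\<lambda>_. 0"]) simp
    next
      case (step c x y)
      obtain t d where t: "finite t" "t \<subseteq> quo ` S" "quo y = (\<Oplus>\<^bsub>P\<^esub>a\<in>t. d a \<odot>\<^bsub>P\<^esub> a)"
        using step by (auto simp: lspan_def)
      \<comment> \<open>\<open>?b\<close> is the coefficient that the image of \<open>x\<close> has already\<close>
      let ?t = "t - {quo x}" and ?b = "if quo x \<in> t then d (quo x) else 0"
      let ?d = "d(quo x := c + ?b)"
      have PiS: "(\<lambda>a. d a \<odot>\<^bsub>P\<^esub> a) \<in> ?t \<rightarrow> carrier P" for d using t(2) smultP by (auto simp: Pi_iff)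
      have zero: "0 \<odot>\<^bsub>P\<^esub> quo x = \<zero>\<^bsub>P\<^esub>" using quo_scale[of 0 x] by (simp add: const_zero quo_zero)
      have sum_t: "quo y = ?b \<odot>\<^bsub>P\<^esub> quo x \<oplus>\<^bsub>P\<^esub> (\<Oplus>\<^bsub>P\<^esub>a\<in>?t. d a \<odot>\<^bsub>P\<^esub> a)"
      proof (cases "quo x \<in> t")
        case True
        then have "t = insert (quo x) ?t" by blast
        then have "quo y = (\<Oplus>\<^bsub>P\<^esub>a\<in>insert (quo x) ?t. d a \<odot>\<^bsub>P\<^esub> a)" using t(3) by simp
        also have "\<dots> = d (quo x) \<odot>\<^bsub>P\<^esub> quo x \<oplus>\<^bsub>P\<^esub> (\<Oplus>\<^bsub>P\<^esub>a\<in>?t. d a \<odot>\<^bsub>P\<^esub> a)"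
          using t(1) PiS smultP by (subst finsum_insert) auto
        finally show ?thesis using True by simp
      next
        case False
        then have "?t = t" by blast
        then show ?thesis using False t(3) zero quoP[of y] by simp
      qed
      have "(\<Oplus>\<^bsub>P\<^esub>a\<in>insert (quo x) ?t. ?d a \<odot>\<^bsub>P\<^esub> a)
          = (c + ?b) \<odot>\<^bsub>P\<^esub> quo x \<oplus>\<^bsub>P\<^esub> (\<Oplus>\<^bsub>P\<^esub>a\<in>?t. ?d a \<odot>\<^bsub>P\<^esub> a)"
        using t(1) PiS[of ?d] smultP[of "c + ?b" x] by (subst finsum_insert) auto
      also have "(\<Oplus>\<^bsub>P\<^esub>a\<in>?t. ?d a \<odot>\<^bsub>P\<^esub> a) = (\<Oplus>\<^bsub>P\<^esub>a\<in>?t. d a \<odot>\<^bsub>P\<^esub> a)"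
        using PiS[of d] by (intro finsum_cong') auto
      also have "(c + ?b) \<odot>\<^bsub>P\<^esub> quo x = c \<odot>\<^bsub>P\<^esub> quo x \<oplus>\<^bsub>P\<^esub> ?b \<odot>\<^bsub>P\<^esub> quo x"
        by (simp add: const_add distrib_right flip: quo_scale quo_add)
      finally have "(\<Oplus>\<^bsub>P\<^esub>a\<in>insert (quo x) ?t. ?d a \<odot>\<^bsub>P\<^esub> a)
          = c \<odot>\<^bsub>P\<^esub> quo x \<oplus>\<^bsub>P\<^esub> quo y"
        unfolding sum_t using smultP finsum_closed[OF PiS[of d]] by (simp add: a_assoc)
      then have "quo (const c * x + y) = (\<Oplus>\<^bsub>P\<^esub>a\<in>insert (quo x) ?t. ?d a \<odot>\<^bsub>P\<^esub> a)"
        by (simp add: quo_add quo_scale)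
      moreover have "insert (quo x) ?t \<subseteq> quo ` S" "finite (insert (quo x) ?t)"
        using t step by auto
      ultimately show ?case
        unfolding lspan_def
        by (intro CollectI exI[of _ "insert (quo x) ?t"] exI[of _ ?d]) simp
    qed
    then show "quo ` span S \<subseteq> lspan P (quo ` S)" by auto
  qed
qed

lemma finsum_quo:
  "finite A \<Longrightarrow> (\<Oplus>\<^bsub>P\<^esub>w\<in>A. c w \<odot>\<^bsub>P\<^esub> quo (f w)) = quo (\<Sum>w\<in>A. const (c w) * f w)"
proof (induction A rule: finite_induct)
  case empty
  interpret abelian_monoid P by (rule abelian_monoid_P)
  show ?case by (simp add: quo_zero)
next
  case (insert a A)
  interpret abelian_monoid P by (rule abelian_monoid_P)
  have "(\<lambda>w. c w \<odot>\<^bsub>P\<^esub> quo (f w)) \<in> A \<rightarrow> carrier P" by (auto simp: carrier_P simp flip: quo_scale)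
  moreover have "c a \<odot>\<^bsub>P\<^esub> quo (f a) \<in> carrier P" by (simp add: carrier_P flip: quo_scale)
  ultimately show ?case using insert by (simp add: quo_add quo_scale)
qed

lemma set_mult_quo: "quo ` S <#>\<^bsub>P\<^esub> quo ` T = quo ` (S * T)"
  by (auto simp: set_mult_def set_times_image image_iff simp flip: quo_mult)

end

section \<open>The algebras $C_n$\<close>

fun sign_coeff :: "sign \<Rightarrow> 'k::field" where
  "sign_coeff Plus = 1"
| "sign_coeff Minus = - 1"

lemma rev_word_sum: "rev_word (sum f A) = (\<Sum>a\<in>A. rev_word (f a))"
  by (induction A rule: infinite_finite_induct) (simp_all add: rev_word_zero rev_word_add)

locale Cn_algebra =
  fixes s :: sign and n :: nat and p q :: "'k::field"
begin

lemma carrier_uX: "1 \<le> i \<Longrightarrow> i < n \<Longrightarrow> (uX i :: gen word \<Rightarrow>\<^sub>0 'k) \<in> carrier (free_algebra (gens n))"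
  by (auto simp: uX_def gens_def intro: carrier_var)

lemma carrier_gX: "1 \<le> i \<Longrightarrow> i < n \<Longrightarrow> gX q i \<in> carrier (free_algebra (gens n))"
  unfolding gX_def by (intro carrier_diff carrier_const carrier_uX)

lemma carrier_eX: "r \<le> n \<Longrightarrow> (eX r :: gen word \<Rightarrow>\<^sub>0 'k) \<in> carrier (free_algebra (gens n))"
  by (auto simp: eX_def gens_def intro: carrier_var carrier_one)

lemma rels_carrier: "rels s n p q \<subseteq> carrier (free_algebra (gens n))"
proof -
  have "hecke_rels n q \<subseteq> carrier (free_algebra (gens n))"
    by (auto simp: hecke_rels_def
        intro!: carrier_diff carrier_mult carrier_add carrier_const carrier_one carrier_gX)
  moreover have "idem_rels s n p q \<subseteq> carrier (free_algebra (gens n))"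
    by (cases s; auto simp: idem_rels_def
        intro!: carrier_diff carrier_mult carrier_const carrier_uX carrier_eX)
  moreover have "(braid_e_rels s n :: (gen word \<Rightarrow>\<^sub>0 'k) set) \<subseteq> carrier (free_algebra (gens n))"
    by (cases s; auto simp: braid_e_rels_def
        intro!: carrier_diff carrier_add carrier_mult carrier_uX carrier_eX)
  moreover have "(tacit_rels s n :: (gen word \<Rightarrow>\<^sub>0 'k) set) \<subseteq> carrier (free_algebra (gens n))"
    by (cases s; auto simp: tacit_rels_def
        intro!: carrier_diff carrier_add carrier_mult carrier_uX carrier_eX)
  ultimately show ?thesis by (simp add: rels_def)
qed

sublocale presentation "gens n" "rels s n p q"
  by standard (rule rels_carrier)

lemma rev_uX: "rev_word (uX i) = (uX i :: gen word \<Rightarrow>\<^sub>0 'k)"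
  by (simp add: uX_def rev_word_var)

lemma rev_gX: "rev_word (gX q i) = gX q i"
  by (simp add: gX_def rev_word_diff rev_word_const rev_uX)

lemma rev_eX: "rev_word (eX r) = (eX r :: gen word \<Rightarrow>\<^sub>0 'k)"
  by (simp add: eX_def rev_word_var rev_word_one)

text \<open>
  The recursion and the Hecke relations are symmetric, up to the exchange of \<open>i\<close> and \<open>j\<close> in the
  commutation of $g_i$ and $g_j$. Reversal exchanges the two braid families with $e_{(r)}$, and it
  changes the sign of the commutator of $e_{(r)}$ and $u_j$.
\<close>

lemma rev_rels:
  assumes "x \<in> rels s n p q"
  shows "rev_word x \<in> rels s n p q \<or> - rev_word x \<in> rels s n p q"
proof -
  note rev = rev_word_diff rev_word_add rev_word_mult rev_word_const_mult rev_word_one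
    rev_word_const rev_uX rev_gX rev_eX
  have "rev_word x \<in> hecke_rels n q" if "x \<in> hecke_rels n q"
  proof -
    from that consider
      (braid) i where "1 \<le> i" "i + 1 < n"
        "x = gX q i * gX q (i+1) * gX q i - gX q (i+1) * gX q i * gX q (i+1)"
      | (far) i j where "i \<in> {1..<n}" "j \<in> {1..<n}" "\<bar>int i - int j\<bar> \<noteq> 1"
        "x = gX q i * gX q j - gX q j * gX q i"
      | (quad) i where "i \<in> {1..<n}" "x = gX q i * gX q i - (const (q - inverse q) * gX q i + 1)"
      unfolding hecke_rels_def by blast
    then show ?thesis
    proof cases
      case braid
      then have "rev_word x = x" by (simp add: rev mult.assoc)
      then show ?thesis using that by simp
    next
      case far
      then have "rev_word x = gX q j * gX q i - gX q i * gX q j" by (simp add: rev)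
      moreover have "\<bar>int j - int i\<bar> \<noteq> 1" using far(3) by linarith
      ultimately show ?thesis using far(1,2) unfolding hecke_rels_def by blast
    next
      case quad
      then have "rev_word x = x" by (simp add: rev const_commute[of "gX q i"])
      then show ?thesis using that by simp
    qed
  qed
  moreover have "rev_word x \<in> idem_rels s n p q" if "x \<in> idem_rels s n p q"
  proof -
    have "rev_word x = x" using that
      by (cases s) (auto simp: idem_rels_def rev mult.assoc const_commute[of "eX r" for r])
    then show ?thesis using that by simp
  qed
  moreover have "rev_word x \<in> tacit_rels s n" if "x \<in> braid_e_rels s n"
  proof -
    from that obtain j r where jr: "2 \<le> j" "j < r" "r \<le> n" "x = braid_e_left s j r"
      by (auto simp: braid_e_rels_def)
    have "rev_word x = braid_e_right s j r"
      unfolding jr(4) by (cases s) (simp_all add: rev)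
    then show ?thesis using jr unfolding tacit_rels_def by blast
  qed
  moreover have "rev_word x \<in> braid_e_rels s n \<or> - rev_word x \<in> tacit_rels s n"
    if x: "x \<in> tacit_rels s n"
  proof -
    from x consider (comm) r j where "1 \<le> r" "r < j" "j < n" "x = eX r * uX j - uX j * eX r"
      | (braid) j r where "2 \<le> j" "j < r" "r \<le> n" "x = braid_e_right s j r"
      unfolding tacit_rels_def by blast
    then show ?thesis
    proof cases
      case comm
      then have "- rev_word x = x" by (simp add: rev)
      then show ?thesis using x by simp
    next
      case braid
      then have "rev_word x = braid_e_left s j r" by (cases s) (simp_all add: rev)
      then show ?thesis using braid unfolding braid_e_rels_def by blast
    qed
  qed
  ultimately show ?thesis using assms unfolding rels_def by blast
qed

lemma sub_const_mult:
  "(const q - x) * (const q - y) = const (q * q) - const q * x - const q * y + x * (y :: gen word \<Rightarrow>\<^sub>0 'k)"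
  using const_commute[of x q] by (simp add: algebra_simps const_mult)

sublocale C_mod_ideal "\<lambda>c x. const c * x" rel_ideal n "q - inverse q" "gX q" "sign_coeff s" "q - e_coeff s p q"
  eX rev_word
proof -
  interpret vector_space "\<lambda>c (x :: gen word \<Rightarrow>\<^sub>0 'k). const c * x" by (rule vector_space_const)
  interpret A: algebra_mod_ideal "\<lambda>c (x :: gen word \<Rightarrow>\<^sub>0 'k). const c * x" rel_ideal
  proof
    fix c and x y :: "gen word \<Rightarrow>\<^sub>0 'k"
    show "const c * x * y = const c * (x * y)" by (rule mult.assoc)
    have "x * (const c * y) = (x * const c) * y" by (simp add: mult.assoc)
    then show "x * (const c * y) = const c * (x * y)" by (simp add: const_commute[of x] mult.assoc)
  qed (simp_all add: rel_ideal_subspace rel_ideal_mult)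

  note K = relator_in_rel_ideal
  show "C_mod_ideal (\<lambda>c (x :: gen word \<Rightarrow>\<^sub>0 'k). const c * x) rel_ideal n (q - inverse q) (gX q)
    (sign_coeff s) (q - e_coeff s p q) eX rev_word"
  proof (intro C_mod_ideal.intro hecke_mod_ideal.intro A.algebra_mod_ideal_axioms
      hecke_mod_ideal_axioms.intro C_mod_ideal_axioms.intro, unfold A.cong_def)
    fix i assume "1 \<le> i" "Suc i < n"
    then show "gX q i * gX q (Suc i) * gX q i - gX q (Suc i) * gX q i * gX q (Suc i) \<in> rel_ideal"
      by (intro K) (auto simp: rels_def hecke_rels_def)
  next
    fix i j assume ij: "1 \<le> i" "Suc i < j" "j < n"
    then have "i \<in> {1..<n}" "j \<in> {1..<n}" "\<bar>int i - int j\<bar> \<noteq> 1" by auto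
    then have "gX q i * gX q j - gX q j * gX q i \<in> hecke_rels n q"
      unfolding hecke_rels_def by blast
    then show "gX q i * gX q j - gX q j * gX q i \<in> rel_ideal"
      by (intro K) (simp add: rels_def)
  next
    fix i assume "1 \<le> i" "i < n"
    then show "gX q i * gX q i - (const (q - inverse q) * gX q i + 1) \<in> rel_ideal"
      by (intro K) (auto simp: rels_def hecke_rels_def)
  next
    show "sign_coeff s * sign_coeff s = 1" by (cases s) simp_all
    show "eX 0 = (1 :: gen word \<Rightarrow>\<^sub>0 'k)" by (simp add: eX_def)
  next
    fix r assume "1 \<le> r" "r \<le> n"
    then show "eX r * eX r - (eX r :: gen word \<Rightarrow>\<^sub>0 'k) \<in> rel_ideal"
      by (intro K) (auto simp: rels_def idem_rels_def)
  next
    fix r assume r: "1 \<le> r" "r < n"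
    let ?e = "eX r :: gen word \<Rightarrow>\<^sub>0 'k" and ?c = "e_coeff s p q"
    \<comment> \<open>in terms of $g_r$ the recursion contains $qe_{(r)}^2$, which is replaced by $qe_{(r)}$\<close>
    have 1: "eX (r+1) - e_next s p q r \<in> rel_ideal"
      using r by (intro K) (auto simp: rels_def idem_rels_def)
    have "?e * ?e - ?e \<in> rel_ideal" using r by (intro K) (auto simp: rels_def idem_rels_def)
    then have 2: "const (sign_coeff s * q) * (?e * ?e - ?e) \<in> rel_ideal" by (rule rel_ideal_mult)
    have u: "?e * uX r * ?e = const q * (?e * ?e) - ?e * gX q r * ?e"
      by (simp add: gX_def right_diff_distrib left_diff_distrib const_commute[of ?e] mult.assoc)
    have "eX (Suc r) - const (sign_coeff s) * (const (q - ?c) * ?e - ?e * gX q r * ?e)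
        = (eX (r+1) - e_next s p q r) + const (sign_coeff s * q) * (?e * ?e - ?e)"
      by (cases s)
        (simp_all add: u const_uminus const_one const_diff left_diff_distrib right_diff_distrib)
    also have "\<dots> \<in> rel_ideal" using 1 2 subspace_add[OF rel_ideal_subspace] by blast
    finally show "eX (Suc r) - const (sign_coeff s) * (const (q - ?c) * ?e - ?e * gX q r * ?e) \<in> rel_ideal" .
  next
    fix r j assume rj: "1 \<le> r" "r < j" "j < n"
    have "eX r * uX j - uX j * eX r \<in> rel_ideal"
      using rj by (intro K) (auto simp: rels_def tacit_rels_def)
    from subspace_neg[OF rel_ideal_subspace this]
    show "eX r * gX q j - gX q j * eX r \<in> rel_ideal"
      using const_commute[of "eX r" q] by (simp add: gX_def algebra_simps)
  next
    fix i r assume ir: "1 \<le> i" "Suc i < r" "r \<le> n"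
    let ?e = "eX r :: gen word \<Rightarrow>\<^sub>0 'k" and ?u = "uX i :: gen word \<Rightarrow>\<^sub>0 'k"
      and ?v = "uX (Suc i) :: gen word \<Rightarrow>\<^sub>0 'k"
    have "2 \<le> Suc i" using ir by simp
    then have "(braid_e_left s (Suc i) r :: gen word \<Rightarrow>\<^sub>0 'k) \<in> braid_e_rels s n"
      unfolding braid_e_rels_def using ir by blast
    then have "braid_e_left s (Suc i) r \<in> rels s n p q" by (simp add: rels_def)
    from subspace_neg[OF rel_ideal_subspace K[OF this]]
    have neg: "- braid_e_left s (Suc i) r \<in> rel_ideal" .
    have "gX q (Suc i) * gX q i - (gX q i * gX q (Suc i) + const (sign_coeff s) * (gX q i - gX q (Suc i)))
        = ?v * ?u - ?u * ?v - const (sign_coeff s) * (?v - ?u)"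
      unfolding gX_def sub_const_mult by simp
    then have "gX q (Suc i) * gX q i * ?e
        - (gX q i * gX q (Suc i) + const (sign_coeff s) * (gX q i - gX q (Suc i))) * ?e
        = (?v * ?u - ?u * ?v - const (sign_coeff s) * (?v - ?u)) * ?e"
      by (metis left_diff_distrib)
    also have "\<dots> = - braid_e_left s (Suc i) r"
      by (cases s) (simp_all add: const_uminus const_one left_diff_distrib right_diff_distrib
          distrib_right)
    finally show "gX q (Suc i) * gX q i * ?e
        - (gX q i * gX q (Suc i) + const (sign_coeff s) * (gX q i - gX q (Suc i))) * ?e \<in> rel_ideal"
      using neg by simp
  next
    show "rev_word (const c * x) = const c * rev_word x" for c x by (rule rev_word_const_mult)
    show "rev_word x \<in> rel_ideal" if "x \<in> rel_ideal" for x
      using rev_word_rel_ideal[OF rev_rels that] .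
  qed (simp_all add: rev_word_add rev_word_mult rev_word_one rev_gX rev_eX)
qed

notation cong (infix "\<asymp>" 50)

abbreviation H_monomials where "H_monomials \<equiv> monomials {1..<n}"

lemma Cn_eq_P: "Cn s n p q = P"
  by (simp add: Cn_def)

lemma quo_cong: "x \<asymp> y \<longleftrightarrow> quo x = quo y"
  by (simp add: cong_def quo_eq_iff)

lemma quo_span: "quo ` span S = quo ` cspan S"
proof
  show "quo ` span S \<subseteq> quo ` cspan S"
    using span_mono[of S "S \<union> rel_ideal"] by (auto simp: cspan_def)
  show "quo ` cspan S \<subseteq> quo ` span S"
  proof
    fix y assume "y \<in> quo ` cspan S"
    then obtain a b where ab: "a \<in> span S" "b \<in> span rel_ideal" "y = quo (a + b)"
      by (auto simp: cspan_def span_Un)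
    have "b \<in> rel_ideal" using ab(2) rel_ideal_subspace by (metis span_eq_iff)
    then have "quo (a + b) = quo a" by (simp add: quo_eq_iff)
    then show "y \<in> quo ` span S" using ab by auto
  qed
qed

lemma lspan_quo_cspan: "lspan (Cn s n p q) (quo ` S) = quo ` cspan S"
  unfolding Cn_eq_P lspan_quo quo_span ..

lemma gC_eq: "1 \<le> i \<Longrightarrow> i < n \<Longrightarrow> gC s n p q i = quo (gX q i)"
  by (simp add: gC_def quo_carrier carrier_gX)

lemma eC_eq: "r \<le> n \<Longrightarrow> eC s n p q r = quo (eX r)"
  by (simp add: eC_def quo_carrier carrier_eX)

lemma gprod_eq: "set x \<subseteq> {1..<n} \<Longrightarrow> gprod s n p q x = quo (g_word x)"
proof (induction x)
  case Nil
  then show ?case by (simp add: gprod_def Cn_eq_P quo_one)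
next
  case (Cons i x)
  then show ?case by (simp add: gprod_def Cn_eq_P quo_mult gC_eq)
qed

lemma hC_eq:
  assumes "w permutes {1..n}" shows "hC s n p q w = quo (h_perm w)"
  unfolding hC_def h_perm_def using someI_ex[OF reduced_exists[OF assms]]
  by (intro gprod_eq reduced_letters)

lemma setC_eq: "setC s n p q r = quo ` C_reps r"
  unfolding setC_def C_reps_def image_image
  by (intro image_cong refl hC_eq) (simp add: shortest_reps_def)

lemma setD_eq: "setD s n p q r = quo ` D_reps r"
  unfolding setD_def D_reps_def image_image
  by (intro image_cong refl hC_eq) (simp add: shortest_reps_def)

lemma times_image: "{a} * T = (\<lambda>x. a * x) ` T"
  by (auto elim: set_times_elim)

lemma setB_eq: "r \<le> n \<Longrightarrow> setB s n p q r = quo ` g_word ` involution_words r"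
proof (induction r rule: involution_words.induct)
  case (3 r)
  have "{gprod s n p q [j..<r+2]} <#>\<^bsub>Cn s n p q\<^esub> setB s n p q r
      = quo ` g_word ` (\<lambda>v. [j..<r+2] @ v) ` involution_words r" if "j \<in> {1..r+1}" for j
  proof -
    have "gprod s n p q [j..<r+2] = quo (g_word [j..<r+2])"
      using that "3.prems" by (intro gprod_eq) auto
    moreover have "setB s n p q r = quo ` g_word ` involution_words r"
      using "3.IH"(2)[OF that] "3.prems" by simp
    ultimately have "{gprod s n p q [j..<r+2]} <#>\<^bsub>Cn s n p q\<^esub> setB s n p q r
        = quo ` ({g_word [j..<r+2]} * g_word ` involution_words r)"
      using set_mult_quo[of "{g_word [j..<r+2]}"] by (simp add: Cn_eq_P)
    also have "{g_word [j..<r+2]} * g_word ` involution_words r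
        = g_word ` (\<lambda>v. [j..<r+2] @ v) ` involution_words r"
      unfolding times_image by (simp add: image_image)
    finally show ?thesis .
  qed
  then have "(\<Union>j\<in>{1..r+1}. {gprod s n p q [j..<r+2]} <#>\<^bsub>Cn s n p q\<^esub> setB s n p q r)
      = quo ` g_word ` (\<Union>j\<in>{1..r+1}. (\<lambda>v. [j..<r+2] @ v) ` involution_words r)"
    unfolding image_UN by (intro SUP_cong refl)
  moreover have "setB s n p q (Suc r) = quo ` g_word ` involution_words (Suc r)" using 3 by simp
  ultimately show ?case unfolding setB.simps involution_words.simps image_Un by (rule_tac arg_cong2[of _ _ _ _ "(\<union>)"])
qed (simp_all add: Cn_eq_P quo_one)

lemma monomials_combination:
  assumes "x \<in> cspan H_monomials"
  shows "\<exists>c. x \<asymp> (\<Sum>w\<in>{w. w permutes {1..n}}. const (c w) * h_perm w)"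
proof -
  let ?W = "{w. w permutes {1..n}}"
  have fin: "finite ?W" by (intro finite_permutations) simp
  have "x \<in> cspan (h_perm ` ?W)" using assms by (simp only: cspan_monomials_eq_h_perm)
  then have "x \<in> span (h_perm ` ?W \<union> rel_ideal)" unfolding cspan_def .
  then show ?thesis
  proof (induction x rule: span_induct_alt)
    case base
    show ?case by (intro exI[of _ "\<lambda>_. 0"]) (simp add: const_zero)
  next
    case (step a x y)
    then obtain c where c: "y \<asymp> (\<Sum>w\<in>?W. const (c w) * h_perm w)" by blast
    show ?case
    proof (cases "x \<in> rel_ideal")
      case True
      then have "const a * x + y \<asymp> 0 + (\<Sum>w\<in>?W. const (c w) * h_perm w)"
        using c rel_ideal_mult by (intro cong_add) (auto simp: cong_def)
      then show ?thesis by auto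
    next
      case False
      then obtain v where v: "v permutes {1..n}" "x = h_perm v" using step by auto
      have "const a * x + y \<asymp> const a * h_perm v + (\<Sum>w\<in>?W. const (c w) * h_perm w)"
        unfolding v(2) using c by (intro cong_add) auto
      also have "const a * h_perm v = (\<Sum>w\<in>?W. if w = v then const a * h_perm w else 0)"
        using fin v(1) by simp
      also have "\<dots> + (\<Sum>w\<in>?W. const (c w) * h_perm w)
          = (\<Sum>w\<in>?W. const ((if w = v then a else 0) + c w) * h_perm w)"
        by (subst sum.distrib[symmetric], rule sum.cong) (auto simp: const_add const_zero distrib_right)
      finally show ?thesis by (rule exI[of _ "\<lambda>w. (if w = v then a else 0) + c w"])
    qed
  qed
qed

text \<open>
  The reversal of a reduced word of \<open>w\<close> is a reduced word of its inverse, and by Matsumoto's theorem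
  it does not matter which one is used.
\<close>

lemma rev_h_perm:
  assumes "w permutes {1..n}" shows "rev_word (h_perm w) \<asymp> h_perm (inv_into UNIV w)"
proof -
  obtain x where x: "reduced n w x" using reduced_exists[OF assms] by blast
  have "rev_word (h_perm w) - rev_word (g_word x) \<in> rel_ideal"
    using rev_ideal h_perm_reduced[OF x] by (simp add: cong_def flip: rev_word_diff)
  then have "rev_word (h_perm w) \<asymp> g_word (rev x)" by (simp add: cong_def rev_g_word)
  also have "\<dots> \<asymp> h_perm (inv_into UNIV w)" using h_perm_reduced[OF reduced_rev[OF x]] by (rule cong_sym)
  finally show ?thesis .
qed

text \<open>
  Whatever coefficients express \<open>x\<close> in the \<open>h\<^sub>w\<close>, the same combination of the $h_{w^{-1}}$ is the
  reversal of \<open>x\<close>. So the value that defines \<open>tr\<close> is unique.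
\<close>

lemma tr_eq:
  assumes "x \<in> cspan H_monomials"
  shows "tr s n p q (quo x) = quo (rev_word x)"
proof -
  let ?W = "{w. w permutes {1..n}}"
  have fin: "finite ?W" by (intro finite_permutations) simp
  have sums: "(\<Oplus>\<^bsub>P\<^esub>w\<in>?W. c w \<odot>\<^bsub>P\<^esub> hC s n p q w) = quo (\<Sum>w\<in>?W. const (c w) * h_perm w)"
    "(\<Oplus>\<^bsub>P\<^esub>w\<in>?W. c w \<odot>\<^bsub>P\<^esub> hC s n p q (inv_into UNIV w))
      = quo (rev_word (\<Sum>w\<in>?W. const (c w) * h_perm w))" for c
  proof -
    interpret M: abelian_monoid P by (rule abelian_monoid_P)
    have mem: "c \<odot>\<^bsub>P\<^esub> quo y \<in> carrier P" for c y by (simp add: carrier_P flip: quo_scale)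
    have "(\<Oplus>\<^bsub>P\<^esub>w\<in>?W. c w \<odot>\<^bsub>P\<^esub> hC s n p q w) = (\<Oplus>\<^bsub>P\<^esub>w\<in>?W. c w \<odot>\<^bsub>P\<^esub> quo (h_perm w))"
      using mem by (intro M.finsum_cong') (auto simp: hC_eq)
    then show "(\<Oplus>\<^bsub>P\<^esub>w\<in>?W. c w \<odot>\<^bsub>P\<^esub> hC s n p q w) = quo (\<Sum>w\<in>?W. const (c w) * h_perm w)"
      using finsum_quo[OF fin] by simp
    have "(\<Oplus>\<^bsub>P\<^esub>w\<in>?W. c w \<odot>\<^bsub>P\<^esub> hC s n p q (inv_into UNIV w))
        = (\<Oplus>\<^bsub>P\<^esub>w\<in>?W. c w \<odot>\<^bsub>P\<^esub> quo (rev_word (h_perm w)))"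
      using mem rev_h_perm
      by (intro M.finsum_cong') (auto simp: hC_eq permutes_inv quo_cong)
    also have "\<dots> = quo (\<Sum>w\<in>?W. const (c w) * rev_word (h_perm w))" by (rule finsum_quo[OF fin])
    also have "(\<Sum>w\<in>?W. const (c w) * rev_word (h_perm w)) = rev_word (\<Sum>w\<in>?W. const (c w) * h_perm w)"
      by (simp add: rev_word_sum rev_word_const_mult)
    finally show "(\<Oplus>\<^bsub>P\<^esub>w\<in>?W. c w \<odot>\<^bsub>P\<^esub> hC s n p q (inv_into UNIV w))
      = quo (rev_word (\<Sum>w\<in>?W. const (c w) * h_perm w))" .
  qed
  have rev: "quo (rev_word y) = quo (rev_word x)" if "quo x = quo y" for y
    using that rev_ideal[of "y - x"] by (simp add: quo_eq_iff rev_word_diff) (metis quo_eq_iff that)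
  obtain c where "x \<asymp> (\<Sum>w\<in>?W. const (c w) * h_perm w)"
    using monomials_combination[OF assms] by blast
  then have c: "quo x = quo (\<Sum>w\<in>?W. const (c w) * h_perm w)" by (simp only: quo_cong)
  show ?thesis
    unfolding tr_def Cn_eq_P sums
  proof (rule the_equality)
    show "\<exists>c. quo x = quo (\<Sum>w\<in>?W. const (c w) * h_perm w) \<and>
        quo (rev_word x) = quo (rev_word (\<Sum>w\<in>?W. const (c w) * h_perm w))"
      by (intro exI[of _ c] conjI c rev[OF c, symmetric])
    show "y = quo (rev_word x)"
      if "\<exists>c. quo x = quo (\<Sum>w\<in>?W. const (c w) * h_perm w) \<and>
        y = quo (rev_word (\<Sum>w\<in>?W. const (c w) * h_perm w))" for y
    proof -
      from that obtain d where d: "quo x = quo (\<Sum>w\<in>?W. const (d w) * h_perm w)"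
        "y = quo (rev_word (\<Sum>w\<in>?W. const (d w) * h_perm w))" by blast
      from rev[OF d(1)] show ?thesis unfolding d(2) .
    qed
  qed
qed

lemma tr_image:
  assumes "S \<subseteq> H_monomials" shows "tr s n p q ` quo ` S = quo ` rev_word ` S"
  unfolding image_image using assms by (intro image_cong refl tr_eq cspan_base) auto

lemma calB_eq:
  assumes "r \<le> n"
  shows "calB s n p q r = quo ` (C_reps r * (g_word ` involution_words r) * {eX r}
      * (rev_word ` g_word ` involution_words r) * (rev_word ` D_reps r))"
proof -
  have "g_word ` involution_words r \<subseteq> H_monomials"
    using involution_words_letters assms by (fastforce intro!: g_word_in_monomials)
  moreover have "D_reps r \<subseteq> H_monomials"
    using h_perm_in_monomials by (auto simp: D_reps_def shortest_reps_def)
  moreover have "{quo (eX r)} = quo ` {eX r}" by simp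
  ultimately show ?thesis
    unfolding calB_def setC_eq setB_eq[OF assms] setD_eq eC_eq[OF assms] Cn_eq_P
    by (simp only: tr_image set_mult_quo)
qed

lemma Hn_eq: "Hn s n p q = quo ` cspan H_monomials"
proof
  let ?A = "free_algebra (U ` {1..<n}) :: (gen word \<Rightarrow>\<^sub>0 'k) ring"
  have sub: "x \<in> carrier F" if "x \<in> carrier ?A" for x
    using that by (auto simp: carrier_free_algebra gens_def)
  have g_A: "gX q i \<in> carrier ?A" if "i \<in> {1..<n}" for i
    unfolding gX_def uX_def using that by (intro carrier_diff carrier_const carrier_var) auto
  have mono_A: "x \<in> carrier ?A" if "x \<in> H_monomials" for x
  proof -
    from that obtain l where l: "set l \<subseteq> {1..<n}" "x = g_word l" by (auto simp: monomials_def)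
    have "set l \<subseteq> {1..<n} \<Longrightarrow> g_word l \<in> carrier ?A"
      by (induction l) (auto intro!: carrier_one carrier_mult g_A simp del: One_nat_def)
    then show ?thesis using l by simp
  qed
  have word_monom_cspan: "word_monom l \<in> cspan H_monomials" if "set l \<subseteq> U ` {1..<n}" for l
    using that
  proof (induction l)
    case Nil
    then show ?case using one_in_monomials by (simp add: word_monom_Nil cspan_base)
  next
    case (Cons a l)
    then obtain i where i: "a = U i" "i \<in> {1..<n}" by auto
    have IH: "word_monom l \<in> cspan H_monomials" using Cons by simp
    have "word_monom (a # l) = (const q - gX q i) * word_monom l"
      using i(1) by (simp add: gX_def uX_def var_eq_monom word_monom_mult)
    also have "\<dots> = const q * word_monom l - gX q i * word_monom l" by (rule left_diff_distrib)
    also have "\<dots> \<in> cspan H_monomials"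
    proof (intro cspan_diff cspan_scale IH cspan_left[OF IH])
      fix y assume "y \<in> H_monomials"
      then show "gX q i * y \<in> cspan H_monomials"
        using gen_in_monomials[OF i(2)] monomials_mult by (blast intro: cspan_base)
    qed
    finally show ?case .
  qed
  have A_cspan: "x \<in> cspan H_monomials" if "x \<in> carrier ?A" for x
    using that
  proof (induction x rule: carrier_induct)
    case (word_monom c l)
    show ?case by (rule cspan_scale[OF word_monom_cspan[OF word_monom]])
  qed (rule cspan_zero, rule cspan_add)
  show "Hn s n p q \<subseteq> quo ` cspan H_monomials"
    unfolding Hn_def using A_cspan sub by (auto simp flip: quo_carrier)
  have "\<exists>y\<in>carrier ?A. quo x = quo y" if "x \<in> cspan H_monomials" for x
    using that unfolding cspan_def
  proof (induction x rule: span_induct_alt)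
    case base
    show ?case using carrier_zero by blast
  next
    case (step c x y)
    then obtain v where v: "v \<in> carrier ?A" "quo y = quo v" by blast
    show ?case
    proof (cases "x \<in> H_monomials")
      case True
      then have "const c * x + v \<in> carrier ?A" using v mono_A by (intro carrier_intros)
      then show ?thesis using v(2) by (metis quo_add)
    next
      case False
      then have "quo x = quo 0" using step by (simp add: quo_eq_iff)
      then have "quo (const c * x + y) = quo (const c * 0 + v)"
        using v(2) by (metis quo_add quo_scale)
      then show ?thesis using v(1) by auto
    qed
  qed
  then show "quo ` cspan H_monomials \<subseteq> Hn s n p q"
    unfolding Hn_def using sub quo_carrier by force
qed

theorem lspan_calB:
  assumes "r \<le> n" shows "lspan (Cn s n p q) (calB s n p q r) = HeH s n p q r"
proof -
  have cc: "cspan (cspan S) = cspan S" for S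
    by (intro cspan_eqI) (auto intro: cspan_base)
  have "{eC s n p q r} = quo ` {eX r}" using eC_eq[OF assms] by simp
  then have "HeH s n p q r = lspan (Cn s n p q) (quo ` (cspan H_monomials * {eX r} * cspan H_monomials))"
    unfolding HeH_def Hn_eq by (simp only: Cn_eq_P set_mult_quo)
  also have "\<dots> = quo ` cspan (H_monomials * {eX r} * H_monomials)"
    unfolding lspan_quo_cspan by (intro arg_cong[of _ _ "(`) quo"] cspan_times_cong refl cc)
  also have "\<dots> = lspan (Cn s n p q) (calB s n p q r)"
    unfolding cspan_HeH[OF assms] calB_eq[OF assms] lspan_quo_cspan ..
  finally show ?thesis ..
qed

text \<open>
  A letter that is not a generator vanishes in the quotient.
\<close>

lemma generated:
  assumes "subspace T" "1 \<in> T" "rel_ideal \<subseteq> T"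
    and g: "\<And>i x. 1 \<le> i \<Longrightarrow> i < n \<Longrightarrow> x \<in> T \<Longrightarrow> gX q i * x \<in> T"
    and e: "\<And>r x. 1 \<le> r \<Longrightarrow> r \<le> n \<Longrightarrow> x \<in> T \<Longrightarrow> eX r * x \<in> T"
  shows "T = (UNIV :: (gen word \<Rightarrow>\<^sub>0 'k) set)"
proof -
  have "word_monom l \<in> T" for l
  proof (induction l)
    case Nil
    then show ?case using assms(2) by (simp add: word_monom_Nil)
  next
    case (Cons a l)
    have al: "(word_monom (a # l) :: gen word \<Rightarrow>\<^sub>0 'k) = var a * word_monom l" by (simp add: var_eq_monom word_monom_mult)
    consider "a \<notin> gens n" | i where "a = U i" "1 \<le> i" "i < n" | r where "a = E r" "1 \<le> r" "r \<le> n"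
      by (cases "a \<in> gens n") (auto simp: gens_def)
    then show ?case
    proof cases
      case 1
      then have "var a * word_monom l \<in> (rel_ideal :: (gen word \<Rightarrow>\<^sub>0 'k) set)" by (intro rel_ideal_mult outside_in_rel_ideal)
      then show ?thesis using assms(3) al by auto
    next
      case 2
      then have "word_monom (a # l) = const q * word_monom l - gX q i * word_monom l"
        unfolding al by (simp add: gX_def uX_def left_diff_distrib)
      then show ?thesis
        using subspace_diff[OF assms(1) subspace_scale[OF assms(1) Cons] g[OF 2(2,3) Cons]] by simp
    next
      case 3
      then have "(word_monom (a # l) :: gen word \<Rightarrow>\<^sub>0 'k) = eX r * word_monom l" unfolding al by (simp add: eX_def)
      then show ?thesis using e[OF 3(2,3) Cons] by simp
    qed
  qed
  then have "x \<in> T" for x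
    by (induction x rule: free_algebra_induct)
      (auto intro: subspace_0[OF assms(1)] subspace_add[OF assms(1)] subspace_scale[OF assms(1)])
  then show ?thesis by auto
qed

theorem lspan_calB_Union:
  "lspan (Cn s n p q) (\<Union>r\<in>{0..n}. calB s n p q r) = carrier (Cn s n p q)"
proof -
  let ?T = "\<lambda>r. C_reps r * (g_word ` involution_words r) * {eX r}
      * (rev_word ` g_word ` involution_words r) * (rev_word ` D_reps r)"
  have "(\<Union>r\<in>{0..n}. calB s n p q r) = quo ` (\<Union>r\<in>{0..n}. ?T r)"
    unfolding image_UN by (intro SUP_cong refl calB_eq) simp
  then have "lspan (Cn s n p q) (\<Union>r\<in>{0..n}. calB s n p q r) = quo ` cspan (\<Union>r\<in>{0..n}. ?T r)"
    by (simp only: lspan_quo_cspan)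
  moreover have "ideal_sum \<subseteq> cspan (\<Union>r\<in>{0..n}. ?T r)"
    unfolding ideal_sum_def
  proof (intro cspan_subset UN_least)
    fix r assume r: "r \<in> {0..n}"
    have "H_monomials * {eX r} * H_monomials \<subseteq> cspan (?T r)"
      using cspan_HeH[of r] r cspan_base by (metis atLeastAtMost_iff subsetI)
    also have "\<dots> \<subseteq> cspan (\<Union>r\<in>{0..n}. ?T r)" using r by (intro cspan_mono) blast
    finally show "H_monomials * {eX r} * H_monomials \<subseteq> cspan (\<Union>r\<in>{0..n}. ?T r)" .
  qed
  then have "cspan (\<Union>r\<in>{0..n}. ?T r) = UNIV" using ideal_sum_UNIV[OF generated] by blast
  ultimately show ?thesis by (simp add: Cn_eq_P carrier_P)
qed

end

theorem proposition2p17: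
  fixes s :: sign and n N :: nat
  assumes "1 \<le> n" and "1 < N" and "odd N"
  shows
    "((\<forall>r\<in>{1..n}. lspan (Cn s n p_var q_var) (calB s n p_var q_var r) = HeH s n p_var q_var r) \<and>
      lspan (Cn s n p_var q_var) (\<Union>r\<in>{0..n}. calB s n p_var q_var r)
        = carrier (Cn s n p_var q_var)) \<and>
     ((\<forall>r\<in>{1..n}. lspan (Cn s n (q_var1 ^ N) q_var1) (calB s n (q_var1 ^ N) q_var1 r)
        = HeH s n (q_var1 ^ N) q_var1 r) \<and>
      lspan (Cn s n (q_var1 ^ N) q_var1) (\<Union>r\<in>{0..n}. calB s n (q_var1 ^ N) q_var1 r)
        = carrier (Cn s n (q_var1 ^ N) q_var1))"
  by (intro conjI ballI Cn_algebra.lspan_calB Cn_algebra.lspan_calB_Union) simp_all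

end
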